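(* Assume $\omega_i/\omega\notin\mathbb{Z}$ for $i=1,\dots,n$. Then the exact, third-order reduced model of the system $$\ddot x+\omega^2x+R(x,\boldsymbol{\eta})=0,\qquad \ddot{\boldsymbol{\eta}}+\boldsymbol{\Omega}^2\boldsymbol{\eta}+\mathbf{S}(x,\boldsymbol{\eta})=\mathbf{0}$$ on its Lyapunov subcenter manifold (that is, the equation $\ddot x+\omega^2x+R(x,\tilde{\mathbf{w}}(x,\dot x))+\mathcal{O}(|(x,\dot x)|^4)=0$ obtained by substituting $\boldsymbol{\eta}=\tilde{\mathbf{w}}(x,\dot x)$ into the first equation) takes the form $$\ddot x+\omega^2x+r_{2\mathbf{0}}x^2+\left(r_{3\mathbf{0}}-\left\langle\mathbf{r}_{1\mathbf{I}},(\boldsymbol{\Omega}^2\mathbf{D}_4)^{-1}\mathbf{D}_2\mathbf{s}_{2\mathbf{0}}\right\rangle\right)x^3+2\left\langle\mathbf{r}_{1\mathbf{I}},(\boldsymbol{\Omega}^2\mathbf{D}_4)^{-1}\mathbf{s}_{2\mathbf{0}}\right\rangle x\dot x^2+\mathcal{O}(|(x,\dot x)|^4)=0,$$ where $\mathbf{D}_2=\boldsymbol{\Omega}^2-2\omega^2\mathbf{I}$ and $\mathbf{D}_4=\boldsymbol{\Omega}^2-4\omega^2\mathbf{I}$.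
   Context: Setting: a conservative (undamped, autonomous) mechanical system with $n+1$ degrees of freedom written in modal coordinates; $x\in\mathbb{R}$, $\boldsymbol{\eta}\in\mathbb{R}^n$, $\omega>0$ is the natural frequency of the $x$-mode, and $\boldsymbol{\Omega}=\mathrm{diag}(\omega_1,\dots,\omega_n)$ contains the natural frequencies of the remaining modes. $R$ and $\mathbf{S}$ are polynomials of degree at most $l$, $2\le l\le3$, without constant and linear terms: $$R(x,\boldsymbol{\eta})=\sum_{j+|\mathbf{k}|=2}^{l}r_{j\mathbf{k}}x^j\eta_1^{k_1}\cdots\eta_n^{k_n},\qquad \mathbf{S}(x,\boldsymbol{\eta})=\sum_{j+|\mathbf{k}|=2}^{l}\mathbf{s}_{j\mathbf{k}}x^j\eta_1^{k_1}\cdots\eta_n^{k_n},$$ $r_{j\mathbf{k}}\in\mathbb{R}$, $\mathbf{s}_{j\mathbf{k}}\in\mathbb{R}^n$, $\mathbf{k}\in\mathbb{N}^n$ (with $0\in\mathbb{N}$; coefficients of order higher than $l$ are zero). $\mathbf{0}\in\mathbb{N}^n$ is the zero index, $\mathbf{e}_j\in\mathbb{N}^n$ the $j$-th unit index, and $\mathbf{r}_{1\mathbf{I}}:=[r_{1\mathbf{e}_1},\dots,r_{1\mathbf{e}_n}]^\top\in\mathbb{R}^n$. $\langle\cdot,\cdot\rangle$ is the Euclidean inner product and $\mathbf{I}$ the identity matrix. Lyapunov subcenter manifold (LSM): it is known (Kelley) that if $\omega_i/\omega\notin\mathbb{Z}$ for all $i$, there is (near the origin) a unique, analytic, two-dimensional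 invariant manifold $\{\boldsymbol{\eta}=\tilde{\mathbf{w}}(x,\dot x),\ \dot{\boldsymbol{\eta}}=\dot{\tilde{\mathbf{w}}}(x,\dot x)\}$ of the system in $\mathbb{R}^{2n+2}$, tangent to the subspace $\boldsymbol{\eta}=\dot{\boldsymbol{\eta}}=\mathbf{0}$ at the trivial fixed point; here $\dot{\tilde{\mathbf{w}}}$ is the time derivative of $\tilde{\mathbf{w}}$ along trajectories in the manifold. *)

theory Defs
  imports "HOL-Analysis.Analysis" "HOL-Library.Landau_Symbols"
begin

text \<open>Multi-indices are vectors over \<^typ>\<open>nat\<close>: the zero index is \<open>0\<close>, the unit indices are \<open>axis i 1\<close>.\<close>

definition mi_order :: "nat ^ 'n \<Rightarrow> nat" where
  "mi_order k = (\<Sum>i\<in>UNIV. k $ i)"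

definition mi_power :: "real ^ 'n \<Rightarrow> nat ^ 'n \<Rightarrow> real" where
  "mi_power \<eta> k = (\<Prod>i\<in>UNIV. \<eta> $ i ^ (k $ i))"

text \<open>Used with real coefficients for \<open>R\<close> and with vector coefficients for \<open>S\<close>.\<close>

definition nonlinearity ::
  "nat \<Rightarrow> (nat \<Rightarrow> nat ^ 'n \<Rightarrow> 'b::real_vector) \<Rightarrow> real \<Rightarrow> real ^ 'n \<Rightarrow> 'b" where
  "nonlinearity l c x \<eta> =
     (\<Sum>(j, k) \<in> {(j, k). 2 \<le> j + mi_order k \<and> j + mi_order k \<le> l}.
        (x ^ j * mi_power \<eta> k) *\<^sub>R c j k)"

definition diag_mat :: "real ^ 'n \<Rightarrow> real ^ 'n ^ 'n" where
  "diag_mat d = (\<chi> i j. if i = j then d $ i else 0)"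

text \<open>Phase space points are \<open>(x, y, \<eta>, \<zeta>)\<close>, where \<open>y\<close> and \<open>\<zeta>\<close> are the velocities of \<open>x\<close> and \<open>\<eta>\<close>.
  The matrix square is written with \<open>**\<close>, since \<open>*\<close> and \<open>^\<close> act componentwise.\<close>

type_synonym 'n phase = "real \<times> real \<times> (real ^ 'n) \<times> (real ^ 'n)"

definition system_field ::
  "real \<Rightarrow> real ^ 'n ^ 'n \<Rightarrow> (real \<Rightarrow> real ^ 'n \<Rightarrow> real) \<Rightarrow> (real \<Rightarrow> real ^ 'n \<Rightarrow> real ^ 'n)
    \<Rightarrow> 'n phase \<Rightarrow> 'n phase" where
  "system_field \<omega> \<Omega> R S = (\<lambda>(x, y, \<eta>, \<zeta>).
     (y, - (\<omega>\<^sup>2 * x + R x \<eta>), \<zeta>, - ((\<Omega> ** \<Omega>) *v \<eta> + S x \<eta>)))"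

text \<open>Local invariance: the trajectory through each point of \<open>M\<close> stays in \<open>M\<close> for a short time
  in both directions.  Local, because the subcenter manifold is a graph over a neighbourhood of the
  origin only.\<close>

definition locally_invariant :: "('a::real_normed_vector \<Rightarrow> 'a) \<Rightarrow> 'a set \<Rightarrow> bool" where
  "locally_invariant F M \<longleftrightarrow>
     (\<forall>p\<in>M. \<exists>\<epsilon>>0. \<exists>\<gamma>. \<gamma> 0 = p \<and>
        (\<forall>t\<in>{-\<epsilon><..<\<epsilon>}. \<gamma> t \<in> M \<and> (\<gamma> has_vector_derivative F (\<gamma> t)) (at t)))"

definition real_analytic_on2 ::
  "(real \<times> real \<Rightarrow> 'b::real_normed_vector) \<Rightarrow> (real \<times> real) set \<Rightarrow> bool" where
  "real_analytic_on2 f U \<longleftrightarrow>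
     (\<forall>(a, b)\<in>U. \<exists>\<rho>>0. \<exists>c :: nat \<Rightarrow> nat \<Rightarrow> 'b. \<forall>(x, y)\<in>ball (a, b) \<rho>.
        ((\<lambda>(i, j). ((x - a) ^ i * (y - b) ^ j) *\<^sub>R c i j) has_sum f (x, y)) UNIV)"

text \<open>The acceleration of \<open>x\<close> in the state \<open>(x, y)\<close> of the reduced model, i.e. after substituting
  \<open>\<eta> = w (x, y)\<close> into the first equation of motion.\<close>

definition reduced_acceleration ::
  "real \<Rightarrow> (real \<Rightarrow> real ^ 'n \<Rightarrow> real) \<Rightarrow> (real \<times> real \<Rightarrow> real ^ 'n) \<Rightarrow> real \<times> real \<Rightarrow> real" where
  "reduced_acceleration \<omega> R w = (\<lambda>(x, y). - (\<omega>\<^sup>2 * x + R x (w (x, y))))"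

text \<open>The time derivative of \<open>w\<close> along trajectories in the manifold, by the chain rule: there the
  velocity of \<open>(x, y)\<close> is \<open>(y, reduced_acceleration \<omega> R w (x, y))\<close>.\<close>

definition w_dot ::
  "real \<Rightarrow> (real \<Rightarrow> real ^ 'n \<Rightarrow> real) \<Rightarrow> (real \<times> real \<Rightarrow> real ^ 'n) \<Rightarrow> real \<times> real \<Rightarrow> real ^ 'n" where
  "w_dot \<omega> R w z = frechet_derivative w (at z) (snd z, reduced_acceleration \<omega> R w z)"

definition graph_param ::
  "real \<Rightarrow> (real \<Rightarrow> real ^ 'n \<Rightarrow> real) \<Rightarrow> (real \<times> real \<Rightarrow> real ^ 'n) \<Rightarrow> real \<times> real \<Rightarrow> 'n phase" where
  "graph_param \<omega> R w = (\<lambda>(x, y). (x, y, w (x, y), w_dot \<omega> R w (x, y)))"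

text \<open>The tangent space of the graph at the fixed point is the range of the derivative of its
  parametrisation.  Only the germ of \<open>w\<close> at the origin matters.\<close>

definition lyapunov_subcenter_manifold ::
  "real \<Rightarrow> real ^ 'n ^ 'n \<Rightarrow> (real \<Rightarrow> real ^ 'n \<Rightarrow> real) \<Rightarrow> (real \<Rightarrow> real ^ 'n \<Rightarrow> real ^ 'n)
    \<Rightarrow> (real \<times> real \<Rightarrow> real ^ 'n) \<Rightarrow> bool" where
  "lyapunov_subcenter_manifold \<omega> \<Omega> R S w \<longleftrightarrow>
     (\<exists>U. open U \<and> (0, 0) \<in> U \<and> real_analytic_on2 w U \<and>
        locally_invariant (system_field \<omega> \<Omega> R S) (graph_param \<omega> R w ` U)) \<and>
     graph_param \<omega> R w (0, 0) = (0, 0, 0, 0) \<and>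
     (\<exists>D. (graph_param \<omega> R w has_derivative D) (at (0, 0)) \<and>
        range D = {(x, y, \<eta>, \<zeta>). \<eta> = 0 \<and> \<zeta> = 0})"

end

theory Submission
  imports Defs
begin

text \<open>
  To third order, the manifold enters the reduced model only through the terms
  \<open>r\<^sub>1\<^sub>e\<^sub>i x \<eta>\<^sub>i\<close>: the parametrisation \<open>w\<close> vanishes to second order at the
  origin, so every other monomial of \<open>R\<close> that involves \<open>\<eta>\<close> has order at least four after the
  substitution \<open>\<eta> = w (x, y)\<close> (\<open>C1_order_nonlinearity_cubic\<close>).  It therefore suffices to
  know the quadratic part \<open>a x\<^sup>2 + b x y + c y\<^sup>2\<close> of each component of \<open>w\<close>, and this quadratic
  part is forced by invariance.

  On the manifold \<open>(x, y)\<close> moves with velocity \<open>(y, - \<omega>\<^sup>2 x - R)\<close>, and differentiating \<open>w\<^sub>i\<close>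
  twice along this field must give \<open>- \<omega>\<^sub>i\<^sup>2 w\<^sub>i - S\<^sub>i\<close> (\<open>invariant_graph_acceleration\<close>).  At
  leading order the field is the harmonic oscillator, whose derivation acts on quadratic forms by
  \<open>(a, b, c) \<mapsto> (- \<omega>\<^sup>2 b, 2 a - 2 \<omega>\<^sup>2 c, b)\<close>.  Comparing the quadratic terms gives a linear system
  for \<open>(a, b, c)\<close>.  The eigenvalues of the squared derivation on quadratic forms are \<open>0\<close> and
  \<open>- 4 \<omega>\<^sup>2\<close>, so the system is uniquely solvable once \<open>\<omega>\<^sub>i\<^sup>2\<close> is neither \<open>0\<close> nor \<open>4 \<omega>\<^sup>2\<close>, which
  the nonresonance hypothesis guarantees.  The solution is
  \<open>b = 0\<close>, \<open>c = 2 s / (\<omega>\<^sub>i\<^sup>2 (\<omega>\<^sub>i\<^sup>2 - 4 \<omega>\<^sup>2))\<close> and \<open>a = - (\<omega>\<^sub>i\<^sup>2 - 2 \<omega>\<^sup>2) c / 2\<close> with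
  \<open>s\<close> the \<open>i\<close>-th component of the coefficient of \<open>x\<^sup>2\<close> in \<open>S\<close>
  (\<open>subcenter_manifold_jet\<close>).

  The comparison needs error terms that may be differentiated.  They are controlled by
  \<open>C1_order m\<close>, which bounds a function by \<open>\<bar>z\<bar>\<^sup>m\<close> and its derivative by \<open>\<bar>z\<bar>\<^sup>m\<^sup>-\<^sup>1\<close>.  Analyticity
  of \<open>w\<close> is used only here: a double power series may be differentiated termwise
  (\<open>power_series2_has_derivative\<close>), so the tail of the series of \<open>w\<close> and those of its partial
  derivatives have the expected \<open>C1_order\<close>.
\<close>

section \<open>Preliminaries\<close>

lemma abs_fst_le_norm: "\<bar>fst z\<bar> \<le> norm z" and abs_snd_le_norm: "\<bar>snd z\<bar> \<le> norm z"
  for z :: "real \<times> real"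
  using norm_fst_le[of "fst z" "snd z"] norm_snd_le[of "snd z" "fst z"] by auto

lemma eventually_norm_less: "0 < d \<Longrightarrow> \<forall>\<^sub>F z in nhds (0 :: real \<times> real). norm z < d"
  unfolding eventually_nhds_metric by (auto simp: dist_norm)

lemma abs_linear_form_le:
  fixes h :: "real \<times> real"
  assumes "\<bar>a\<bar> \<le> A" "\<bar>b\<bar> \<le> B"
  shows "\<bar>fst h * a + snd h * b\<bar> \<le> (A + B) * norm h"
proof -
  have "\<bar>fst h * a\<bar> \<le> norm h * A" "\<bar>snd h * b\<bar> \<le> norm h * B"
    unfolding abs_mult using assms abs_fst_le_norm[of h] abs_snd_le_norm[of h]
    by (auto intro: mult_mono)
  then show ?thesis
    using abs_triangle_ineq[of "fst h * a" "snd h * b"] by (simp add: algebra_simps)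
qed

lemma has_derivative_vec_componentwise:
  fixes w :: "'a::real_normed_vector \<Rightarrow> real ^ 'n"
  assumes "\<And>i. ((\<lambda>z. w z $ i) has_derivative (\<lambda>h. D h $ i)) (at z)"
  shows "(w has_derivative D) (at z)"
  unfolding has_derivative_componentwise_within[of w]
  using assms by (auto simp: Basis_vec_def inner_axis)

section \<open>Double power series\<close>

text \<open>
  Absolute convergence at the corner \<open>(\<rho>, \<rho>)\<close>.  By comparison it gives uniform convergence on the
  closed Euclidean disc of radius \<open>\<rho>\<close>.
\<close>

definition coeff_summable :: "(nat \<Rightarrow> nat \<Rightarrow> real) \<Rightarrow> real \<Rightarrow> bool" where
  "coeff_summable c \<rho> \<longleftrightarrow> (\<lambda>(i, j). \<bar>c i j\<bar> * \<rho> ^ (i + j)) summable_on UNIV"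

definition power_series2 :: "(nat \<Rightarrow> nat \<Rightarrow> real) \<Rightarrow> real \<times> real \<Rightarrow> real" where
  "power_series2 c z = (\<Sum>\<^sub>\<infinity>(i, j). c i j * fst z ^ i * snd z ^ j)"

definition coeff_dx :: "(nat \<Rightarrow> nat \<Rightarrow> real) \<Rightarrow> nat \<Rightarrow> nat \<Rightarrow> real" where
  "coeff_dx c i j = real (Suc i) * c (Suc i) j"

definition coeff_dy :: "(nat \<Rightarrow> nat \<Rightarrow> real) \<Rightarrow> nat \<Rightarrow> nat \<Rightarrow> real" where
  "coeff_dy c i j = real (Suc j) * c i (Suc j)"

lemma monomial_bound:
  fixes z :: "real \<times> real"
  shows "\<bar>a * fst z ^ i * snd z ^ j\<bar> \<le> \<bar>a\<bar> * norm z ^ (i + j)"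
proof -
  have "\<bar>fst z\<bar> ^ i * \<bar>snd z\<bar> ^ j \<le> norm z ^ i * norm z ^ j"
    using abs_fst_le_norm[of z] abs_snd_le_norm[of z] by (intro mult_mono power_mono) auto
  then show ?thesis
    by (simp add: abs_mult power_abs power_add mult.assoc mult_left_mono)
qed

lemma power_series2_abs_summable:
  assumes "coeff_summable c \<rho>" "norm z \<le> \<rho>"
  shows "(\<lambda>(i, j). \<bar>c i j * fst z ^ i * snd z ^ j\<bar>) summable_on UNIV"
proof (rule summable_on_comparison_test)
  show "(\<lambda>(i, j). \<bar>c i j\<bar> * \<rho> ^ (i + j)) summable_on UNIV"
    using assms(1) by (simp add: coeff_summable_def)
  have "\<bar>c i j * fst z ^ i * snd z ^ j\<bar> \<le> \<bar>c i j\<bar> * \<rho> ^ (i + j)" for i j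
    by (rule order.trans[OF monomial_bound])
       (use assms(2) in \<open>auto intro!: mult_left_mono power_mono\<close>)
  then show "(case p of (i, j) \<Rightarrow> \<bar>c i j * fst z ^ i * snd z ^ j\<bar>)
      \<le> (case p of (i, j) \<Rightarrow> \<bar>c i j\<bar> * \<rho> ^ (i + j))" for p
    by (auto split: prod.split)
qed auto

lemma power_series2_has_sum:
  assumes "coeff_summable c \<rho>" "norm z \<le> \<rho>"
  shows "((\<lambda>(i, j). c i j * fst z ^ i * snd z ^ j) has_sum power_series2 c z) UNIV"
  unfolding power_series2_def
  by (rule has_sum_infsum[OF abs_summable_summable])
     (use power_series2_abs_summable[OF assms] in \<open>simp add: case_prod_unfold\<close>)

text \<open>
  A monomial of degree \<open>d \<ge> m\<close> shrinks by the factor \<open>(\<bar>z\<bar> / \<rho>)\<^sup>d \<le> (\<bar>z\<bar> / \<rho>)\<^sup>m\<close> compared with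
  its majorant at \<open>(\<rho>, \<rho>)\<close>, so the majorant series times \<open>(\<bar>z\<bar> / \<rho>)\<^sup>m\<close> bounds the sum.
\<close>

lemma power_series2_bound:
  assumes "coeff_summable c \<rho>" "0 < \<rho>" and low: "\<And>i j. i + j < m \<Longrightarrow> c i j = 0"
  shows "\<exists>K\<ge>0. \<forall>z. norm z \<le> \<rho> \<longrightarrow> \<bar>power_series2 c z\<bar> \<le> K * norm z ^ m"
proof (intro exI conjI allI impI)
  let ?M = "\<lambda>(i, j). \<bar>c i j\<bar> * \<rho> ^ (i + j)"
  have sM: "?M summable_on UNIV"
    using assms(1) by (simp add: coeff_summable_def)
  show "0 \<le> infsum ?M UNIV / \<rho> ^ m"
    using assms(2) by (intro divide_nonneg_nonneg infsum_nonneg) auto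
  fix z :: "real \<times> real" assume z: "norm z \<le> \<rho>"
  have le: "\<bar>c i j * fst z ^ i * snd z ^ j\<bar> \<le> \<bar>c i j\<bar> * \<rho> ^ (i + j) * (norm z ^ m / \<rho> ^ m)" for i j
  proof (cases "i + j < m")
    case False
    have "norm z ^ (i + j) = norm z ^ m * norm z ^ (i + j - m)"
      using False by (simp flip: power_add)
    also have "\<dots> \<le> norm z ^ m * \<rho> ^ (i + j - m)"
      using z by (intro mult_left_mono power_mono) auto
    also have "\<dots> = \<rho> ^ (i + j) * (norm z ^ m / \<rho> ^ m)"
      using False assms(2) by (simp add: power_diff)
    finally have "\<bar>c i j\<bar> * norm z ^ (i + j) \<le> \<bar>c i j\<bar> * (\<rho> ^ (i + j) * (norm z ^ m / \<rho> ^ m))"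
      by (rule mult_left_mono) simp
    then show ?thesis using monomial_bound[of "c i j" z i j] by (simp add: mult.assoc)
  qed (simp add: low)
  have "\<bar>power_series2 c z\<bar> \<le> (\<Sum>\<^sub>\<infinity>p. norm (case p of (i, j) \<Rightarrow> c i j * fst z ^ i * snd z ^ j))"
    unfolding power_series2_def using power_series2_abs_summable[OF assms(1) z]
    by (subst real_norm_def[symmetric], intro norm_infsum_bound) (simp add: case_prod_unfold)
  also have "\<dots> \<le> (\<Sum>\<^sub>\<infinity>p. ?M p * (norm z ^ m / \<rho> ^ m))"
    using power_series2_abs_summable[OF assms(1) z] le sM
    by (intro infsum_mono summable_on_cmult_left) (auto simp: case_prod_unfold)
  also have "\<dots> = infsum ?M UNIV / \<rho> ^ m * norm z ^ m"
    by (subst infsum_cmult_left') simp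
  finally show "\<bar>power_series2 c z\<bar> \<le> infsum ?M UNIV / \<rho> ^ m * norm z ^ m" .
qed

text \<open>
  Differentiating in one variable kills the monomials without that variable; this lemma reindexes the
  remaining ones by the shifts \<open>(i, j) \<mapsto> (i + 1, j)\<close> and \<open>(i, j) \<mapsto> (i, j + 1)\<close>.
\<close>

lemma has_sum_reindex_supported:
  fixes F :: "'a \<Rightarrow> 'b::{comm_monoid_add, topological_space}"
  assumes "inj h" "\<And>p. p \<notin> range h \<Longrightarrow> F p = 0"
  shows "(F has_sum S) UNIV \<longleftrightarrow> ((\<lambda>p. F (h p)) has_sum S) UNIV"
proof -
  have "(F has_sum S) UNIV \<longleftrightarrow> (F has_sum S) (range h)"
    by (rule has_sum_cong_neutral) (use assms in auto)
  also have "\<dots> \<longleftrightarrow> ((\<lambda>p. F (h p)) has_sum S) UNIV"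
    using has_sum_reindex[OF assms(1)] by (simp add: o_def)
  finally show ?thesis .
qed

text \<open>
  Each of the \<open>n + 1\<close> copies of \<open>t\<^sup>n\<close> is at most the corresponding term of the geometric series.
\<close>

lemma Suc_times_power_le:
  fixes t :: real
  assumes "0 \<le> t" "t < 1"
  shows "real (Suc n) * t ^ n \<le> 1 / (1 - t)"
proof -
  have "real (Suc n) * t ^ n = (\<Sum>k\<le>n. t ^ n)" by simp
  also have "\<dots> \<le> (\<Sum>k\<le>n. t ^ k)"
    using assms by (intro sum_mono power_decreasing) auto
  also have "\<dots> \<le> 1 / (1 - t)"
    using assms by (simp add: sum_gp0 divide_right_mono)
  finally show ?thesis .
qed

lemma inj_shift: "inj (\<lambda>(i, j). (Suc i, j))" "inj (\<lambda>(i, j). (i, Suc j))"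
  by (auto simp: inj_on_def)

lemma range_shift: "p \<notin> range (\<lambda>(i::nat, j::nat). (Suc i, j)) \<Longrightarrow> fst p = 0"
   "p \<notin> range (\<lambda>(i::nat, j::nat). (i, Suc j)) \<Longrightarrow> snd p = 0"
  by (metis (mono_tags, lifting) case_prod_conv not0_implies_Suc prod.collapse rangeI)+

text \<open>
  Passing from radius \<open>\<rho>\<close> to a smaller \<open>\<sigma>\<close> leaves the factor \<open>(\<sigma> / \<rho>)\<^sup>n\<close>, and
  \<open>Suc_times_power_le\<close> shows that it absorbs the degree factor that differentiation produces.
\<close>

lemma coeff_summable_shift:
  assumes "coeff_summable c \<rho>" "0 < \<sigma>" "\<sigma> < \<rho>" "inj h"
    and deg: "\<And>i j. fst (h (i, j)) + snd (h (i, j)) = Suc (i + j)"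
    and c': "\<And>i j. \<bar>c' i j\<bar> \<le> real (Suc (i + j)) * \<bar>c (fst (h (i, j))) (snd (h (i, j)))\<bar>"
  shows "coeff_summable c' \<sigma>"
proof -
  let ?M = "\<lambda>(i, j). \<bar>c i j\<bar> * \<rho> ^ (i + j)"
  have "?M summable_on range h"
    using assms(1) unfolding coeff_summable_def by (rule summable_on_subset_banach) simp
  then have "(?M \<circ> h) summable_on UNIV"
    using summable_on_reindex[OF assms(4)] by blast
  then have sM: "(\<lambda>p. 1 / (\<rho> - \<sigma>) * (?M \<circ> h) p) summable_on UNIV"
    by (rule summable_on_cmult_right)
  have "\<bar>c' i j\<bar> * \<sigma> ^ (i + j) \<le> 1 / (\<rho> - \<sigma>) * ?M (h (i, j))" for i j
  proof -
    let ?a = "\<bar>c (fst (h (i, j))) (snd (h (i, j)))\<bar>" and ?n = "i + j"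
    have "\<bar>c' i j\<bar> * \<sigma> ^ ?n \<le> real (Suc ?n) * ?a * \<sigma> ^ ?n"
      using c'[of i j] assms(2) by (intro mult_right_mono) auto
    also have "\<dots> = (real (Suc ?n) * (\<sigma> / \<rho>) ^ ?n) * (\<rho> ^ ?n * ?a)"
      using assms(2,3) by (simp add: power_divide)
    also have "\<dots> \<le> (1 / (1 - \<sigma> / \<rho>)) * (\<rho> ^ ?n * ?a)"
      using assms(2,3) by (intro mult_right_mono Suc_times_power_le) auto
    also have "\<dots> = 1 / (\<rho> - \<sigma>) * (?a * \<rho> ^ Suc ?n)"
      using assms(2,3) by (simp add: field_simps)
    also have "\<dots> = 1 / (\<rho> - \<sigma>) * ?M (h (i, j))"
      by (simp only: case_prod_unfold deg)
    finally show ?thesis .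
  qed
  then show ?thesis
    unfolding coeff_summable_def
    by (intro summable_on_comparison_test[OF sM]) (use assms(2) in auto)
qed

lemma coeff_summable_dx:
  assumes "coeff_summable c \<rho>" "0 < \<sigma>" "\<sigma> < \<rho>"
  shows "coeff_summable (coeff_dx c) \<sigma>"
  by (rule coeff_summable_shift[OF assms inj_shift(1)])
     (auto simp: coeff_dx_def abs_mult intro!: mult_right_mono)

lemma coeff_summable_dy:
  assumes "coeff_summable c \<rho>" "0 < \<sigma>" "\<sigma> < \<rho>"
  shows "coeff_summable (coeff_dy c) \<sigma>"
  by (rule coeff_summable_shift[OF assms inj_shift(2)])
     (auto simp: coeff_dy_def abs_mult intro!: mult_right_mono)

lemma sums_prod_decode:
  fixes F :: "nat \<times> nat \<Rightarrow> real"
  assumes "(F has_sum S) UNIV"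
  shows "(\<lambda>n. F (prod_decode n)) sums S"
  using assms has_sum_reindex_bij_betw[OF bij_prod_decode, of F S] has_sum_imp_sums by blast

text \<open>
  The theorem on derivatives of series concerns sequences of partial sums, so double series are
  enumerated along \<open>prod_decode\<close>; absolute convergence makes the enumeration harmless.
\<close>

lemma uniform_limit_prod_decode:
  fixes F :: "nat \<times> nat \<Rightarrow> real \<times> real \<Rightarrow> real"
  assumes "\<And>p z. z \<in> A \<Longrightarrow> \<bar>F p z\<bar> \<le> M p" "M summable_on UNIV"
    and "\<And>z. z \<in> A \<Longrightarrow> ((\<lambda>p. F p z) has_sum G z) UNIV"
  shows "uniform_limit A (\<lambda>n z. \<Sum>k<n. F (prod_decode k) z) G sequentially"
proof -
  have "summable (\<lambda>n. M (prod_decode n))"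
    using sums_prod_decode[OF has_sum_infsum[OF assms(2)]] by (simp add: sums_iff)
  then have "uniform_limit A (\<lambda>n z. \<Sum>k<n. F (prod_decode k) z)
      (\<lambda>z. suminf (\<lambda>k. F (prod_decode k) z)) sequentially"
    by (intro Weierstrass_m_test) (use assms(1) in auto)
  moreover have "suminf (\<lambda>k. F (prod_decode k) z) = G z" if "z \<in> A" for z
    using sums_prod_decode[OF assms(3)[OF that]] by (simp add: sums_iff)
  ultimately show ?thesis
    by (simp cong: uniform_limit_cong')
qed

text \<open>
  Termwise differentiation: the two series of partial derivatives have the majorants
  \<open>MX\<close> and \<open>MY\<close> on the disc of radius \<open>\<sigma>\<close>, so their partial sums converge uniformly there.
\<close>

lemma power_series2_has_derivative:
  assumes c: "coeff_summable c \<rho>" and \<sigma>: "0 < \<sigma>" "\<sigma> < \<rho>" and z: "norm z < \<sigma>"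
  shows "(power_series2 c has_derivative
    (\<lambda>h. fst h * power_series2 (coeff_dx c) z + snd h * power_series2 (coeff_dy c) z)) (at z)"
proof -
  let ?B = "ball (0 :: real \<times> real) \<sigma>"
  define X where "X = (\<lambda>p (z :: real \<times> real). case p of (i, j) \<Rightarrow>
     c i j * (real i * fst z ^ (i - 1)) * snd z ^ j)"
  define Y where "Y = (\<lambda>p (z :: real \<times> real). case p of (i, j) \<Rightarrow>
     c i j * fst z ^ i * (real j * snd z ^ (j - 1)))"
  define F where "F = (\<lambda>p (z :: real \<times> real). case p of (i, j) \<Rightarrow> c i j * fst z ^ i * snd z ^ j)"
  have cx: "coeff_summable (coeff_dx c) \<sigma>" and cy: "coeff_summable (coeff_dy c) \<sigma>"
    using coeff_summable_dx coeff_summable_dy c \<sigma> by blast+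
  have X: "((\<lambda>p. X p z) has_sum power_series2 (coeff_dx c) z) UNIV" if "z \<in> ?B" for z
  proof -
    have "(\<lambda>p. X ((\<lambda>(i, j). (Suc i, j)) p) z) = (\<lambda>(i, j). coeff_dx c i j * fst z ^ i * snd z ^ j)"
      by (auto simp: X_def coeff_dx_def)
    moreover have "X p z = 0" if "p \<notin> range (\<lambda>(i, j). (Suc i, j))" for p
      using range_shift(1)[OF that] by (simp add: X_def case_prod_unfold)
    ultimately show ?thesis
      using power_series2_has_sum[OF cx, of z] that
      by (subst has_sum_reindex_supported[OF inj_shift(1)]) auto
  qed
  have Y: "((\<lambda>p. Y p z) has_sum power_series2 (coeff_dy c) z) UNIV" if "z \<in> ?B" for z
  proof -
    have "(\<lambda>p. Y ((\<lambda>(i, j). (i, Suc j)) p) z) = (\<lambda>(i, j). coeff_dy c i j * fst z ^ i * snd z ^ j)"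
      by (auto simp: Y_def coeff_dy_def)
    moreover have "Y p z = 0" if "p \<notin> range (\<lambda>(i, j). (i, Suc j))" for p
      using range_shift(2)[OF that] by (simp add: Y_def case_prod_unfold)
    ultimately show ?thesis
      using power_series2_has_sum[OF cy, of z] that
      by (subst has_sum_reindex_supported[OF inj_shift(2)]) auto
  qed
  define MX where "MX = (\<lambda>(i, j). real i * \<bar>c i j\<bar> * \<sigma> ^ (i - 1 + j))"
  define MY where "MY = (\<lambda>(i, j). real j * \<bar>c i j\<bar> * \<sigma> ^ (i + (j - 1)))"
  have "MX summable_on UNIV"
  proof -
    from cx obtain S where "((\<lambda>(i, j). \<bar>coeff_dx c i j\<bar> * \<sigma> ^ (i + j)) has_sum S) UNIV"
      by (auto simp: coeff_summable_def summable_on_def)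
    moreover have "(\<lambda>p. MX ((\<lambda>(i, j). (Suc i, j)) p)) = (\<lambda>(i, j). \<bar>coeff_dx c i j\<bar> * \<sigma> ^ (i + j))"
      by (auto simp: MX_def coeff_dx_def abs_mult)
    moreover have "MX p = 0" if "p \<notin> range (\<lambda>(i, j). (Suc i, j))" for p
      using range_shift(1)[OF that] by (simp add: MX_def case_prod_unfold)
    ultimately have "(MX has_sum S) UNIV"
      by (subst has_sum_reindex_supported[OF inj_shift(1)]) auto
    then show ?thesis by (auto simp: summable_on_def)
  qed
  moreover have "\<bar>X p z\<bar> \<le> MX p" if "z \<in> ?B" for p z
  proof -
    have "\<bar>(c i j * real i) * fst z ^ (i - 1) * snd z ^ j\<bar> \<le> \<bar>c i j * real i\<bar> * \<sigma> ^ (i - 1 + j)" for i j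
      by (rule order.trans[OF monomial_bound])
         (use that in \<open>auto intro!: mult_left_mono power_mono\<close>)
    then show ?thesis
      by (cases p) (simp add: X_def MX_def abs_mult mult_ac)
  qed
  ultimately have uX: "uniform_limit ?B (\<lambda>n z. \<Sum>k<n. X (prod_decode k) z)
      (power_series2 (coeff_dx c)) sequentially"
    using X by (intro uniform_limit_prod_decode) auto
  have "MY summable_on UNIV"
  proof -
    from cy obtain S where "((\<lambda>(i, j). \<bar>coeff_dy c i j\<bar> * \<sigma> ^ (i + j)) has_sum S) UNIV"
      by (auto simp: coeff_summable_def summable_on_def)
    moreover have "(\<lambda>p. MY ((\<lambda>(i, j). (i, Suc j)) p)) = (\<lambda>(i, j). \<bar>coeff_dy c i j\<bar> * \<sigma> ^ (i + j))"
      by (auto simp: MY_def coeff_dy_def abs_mult)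
    moreover have "MY p = 0" if "p \<notin> range (\<lambda>(i, j). (i, Suc j))" for p
      using range_shift(2)[OF that] by (simp add: MY_def case_prod_unfold)
    ultimately have "(MY has_sum S) UNIV"
      by (subst has_sum_reindex_supported[OF inj_shift(2)]) auto
    then show ?thesis by (auto simp: summable_on_def)
  qed
  moreover have "\<bar>Y p z\<bar> \<le> MY p" if "z \<in> ?B" for p z
  proof -
    have "\<bar>(c i j * real j) * fst z ^ i * snd z ^ (j - 1)\<bar> \<le> \<bar>c i j * real j\<bar> * \<sigma> ^ (i + (j - 1))" for i j
      by (rule order.trans[OF monomial_bound])
         (use that in \<open>auto intro!: mult_left_mono power_mono\<close>)
    then show ?thesis
      by (cases p) (simp add: Y_def MY_def abs_mult mult_ac)
  qed
  ultimately have uY: "uniform_limit ?B (\<lambda>n z. \<Sum>k<n. Y (prod_decode k) z)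
      (power_series2 (coeff_dy c)) sequentially"
    using Y by (intro uniform_limit_prod_decode) auto
  have F: "(\<lambda>n. F (prod_decode n) z) sums power_series2 c z" if "z \<in> ?B" for z
    using power_series2_has_sum[OF c, of z] that \<sigma>
    by (intro sums_prod_decode) (auto simp: F_def case_prod_unfold)
  have "\<exists>g. \<forall>z\<in>?B. (\<lambda>n. F (prod_decode n) z) sums g z \<and>
      (g has_derivative (\<lambda>h. fst h * power_series2 (coeff_dx c) z +
         snd h * power_series2 (coeff_dy c) z)) (at z within ?B)"
  proof (rule has_derivative_series[where x = 0])
    fix n and z :: "real \<times> real"
    obtain i j where ij: "prod_decode n = (i, j)" by fastforce
    show "(F (prod_decode n) has_derivative
       (\<lambda>h. fst h * X (prod_decode n) z + snd h * Y (prod_decode n) z)) (at z within ?B)"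
      unfolding F_def X_def Y_def ij by (auto intro!: derivative_eq_intros simp: algebra_simps)
  next
    fix e :: real assume e: "0 < e"
    have "\<forall>\<^sub>F n in sequentially. (\<forall>z\<in>?B. \<bar>(\<Sum>k<n. X (prod_decode k) z) - power_series2 (coeff_dx c) z\<bar> < e / 2)
       \<and> (\<forall>z\<in>?B. \<bar>(\<Sum>k<n. Y (prod_decode k) z) - power_series2 (coeff_dy c) z\<bar> < e / 2)"
      using uniform_limitD[OF uX, of "e / 2"] uniform_limitD[OF uY, of "e / 2"] e
      by (auto simp: dist_real_def intro: eventually_conj)
    then show "\<forall>\<^sub>F n in sequentially. \<forall>z\<in>?B. \<forall>h.
       norm ((\<Sum>k<n. fst h * X (prod_decode k) z + snd h * Y (prod_decode k) z)
         - (fst h * power_series2 (coeff_dx c) z + snd h * power_series2 (coeff_dy c) z)) \<le> e * norm h"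
    proof (rule eventually_mono, intro ballI allI)
      fix n and z h :: "real \<times> real"
      let ?x = "(\<Sum>k<n. X (prod_decode k) z) - power_series2 (coeff_dx c) z"
      let ?y = "(\<Sum>k<n. Y (prod_decode k) z) - power_series2 (coeff_dy c) z"
      assume *: "(\<forall>z\<in>?B. \<bar>(\<Sum>k<n. X (prod_decode k) z) - power_series2 (coeff_dx c) z\<bar> < e / 2)
       \<and> (\<forall>z\<in>?B. \<bar>(\<Sum>k<n. Y (prod_decode k) z) - power_series2 (coeff_dy c) z\<bar> < e / 2)"
        and "z \<in> ?B"
      then have "\<bar>?x\<bar> \<le> e / 2" "\<bar>?y\<bar> \<le> e / 2" by (auto intro: less_imp_le)
      then have "\<bar>fst h * ?x + snd h * ?y\<bar> \<le> (e / 2 + e / 2) * norm h"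
        by (rule abs_linear_form_le)
      then show "norm ((\<Sum>k<n. fst h * X (prod_decode k) z + snd h * Y (prod_decode k) z)
         - (fst h * power_series2 (coeff_dx c) z + snd h * power_series2 (coeff_dy c) z)) \<le> e * norm h"
        by (simp only: sum.distrib sum_distrib_left[symmetric] real_norm_def right_diff_distrib
              add_diff_add field_sum_of_halves)
    qed
  next
    show "(\<lambda>n. F (prod_decode n) 0) sums power_series2 c 0"
      using F[of 0] \<sigma> by simp
  qed (use \<sigma> in auto)
  then obtain g where g: "\<And>z. z \<in> ?B \<Longrightarrow> (\<lambda>n. F (prod_decode n) z) sums g z"
    "\<And>z. z \<in> ?B \<Longrightarrow> (g has_derivative (\<lambda>h. fst h * power_series2 (coeff_dx c) z +
         snd h * power_series2 (coeff_dy c) z)) (at z within ?B)"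
    by blast
  have eq: "g z = power_series2 c z" if "z \<in> ?B" for z
    using sums_unique2[OF g(1)[OF that] F[OF that]] .
  have zB: "z \<in> ?B" using z by simp
  have "(g has_derivative (\<lambda>h. fst h * power_series2 (coeff_dx c) z +
         snd h * power_series2 (coeff_dy c) z)) (at z)"
    using g(2)[OF zB] at_within_open[OF zB] by simp
  then show ?thesis
    by (rule has_derivative_transform_within_open[OF _ open_ball zB eq])
qed

definition coeff_tail :: "nat \<Rightarrow> (nat \<Rightarrow> nat \<Rightarrow> real) \<Rightarrow> nat \<Rightarrow> nat \<Rightarrow> real" where
  "coeff_tail m c i j = (if i + j < m then 0 else c i j)"

lemma coeff_summable_tail:
  assumes "coeff_summable c \<rho>" "0 < \<rho>"
  shows "coeff_summable (coeff_tail m c) \<rho>"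
  using assms unfolding coeff_summable_def
  by (elim summable_on_comparison_test) (auto simp: coeff_tail_def)

lemma power_series2_split:
  assumes "coeff_summable c \<rho>" "0 < \<rho>" "norm z \<le> \<rho>"
  shows "power_series2 c z =
    (\<Sum>i<m. \<Sum>j<m - i. c i j * fst z ^ i * snd z ^ j) + power_series2 (coeff_tail m c) z"
proof -
  let ?D = "SIGMA i:{..<m}. {..<m - i}"
  let ?T = "\<lambda>(i, j). c i j * fst z ^ i * snd z ^ j"
  have "((\<lambda>p. if p \<in> ?D then ?T p else 0) has_sum (\<Sum>p\<in>?D. ?T p)) UNIV"
    by (rule has_sum_finite_neutralI[of ?D]) auto
  then have "((\<lambda>p. (if p \<in> ?D then ?T p else 0) +
       (case p of (i, j) \<Rightarrow> coeff_tail m c i j * fst z ^ i * snd z ^ j)) has_sum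
      ((\<Sum>p\<in>?D. ?T p) + power_series2 (coeff_tail m c) z)) UNIV"
    using power_series2_has_sum[OF coeff_summable_tail[OF assms(1,2)] assms(3)]
    by (rule has_sum_add)
  moreover have "(if p \<in> ?D then ?T p else 0) +
       (case p of (i, j) \<Rightarrow> coeff_tail m c i j * fst z ^ i * snd z ^ j) = ?T p" for p
    by (cases p) (auto simp: coeff_tail_def)
  ultimately have "(?T has_sum ((\<Sum>p\<in>?D. ?T p) + power_series2 (coeff_tail m c) z)) UNIV"
    by simp
  moreover have "(\<Sum>p\<in>?D. ?T p) = (\<Sum>i<m. \<Sum>j<m - i. c i j * fst z ^ i * snd z ^ j)"
    by (simp add: sum.Sigma)
  ultimately show ?thesis
    using has_sum_unique[OF power_series2_has_sum[OF assms(1,3)]] by simp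
qed

lemma power_series2_at_zero:
  assumes "coeff_summable c \<rho>" "0 < \<rho>"
  shows "power_series2 c 0 = c 0 0"
proof -
  obtain K where "\<And>z. norm z \<le> \<rho> \<Longrightarrow> \<bar>power_series2 (coeff_tail 1 c) z\<bar> \<le> K * norm z ^ 1"
    using power_series2_bound[OF coeff_summable_tail[OF assms] assms(2), of 1 1]
    unfolding coeff_tail_def by force
  from this[of 0] show ?thesis
    using power_series2_split[OF assms, of 0 1] assms(2) by simp
qed

text \<open>
  Convergence at one point of the diagonal is enough: for real series it is automatically absolute,
  and it dominates the whole disc.  The radius \<open>\<sigma> / 3\<close> keeps the corner \<open>(\<sigma> / 3, \<sigma> / 3)\<close> inside
  the ball of radius \<open>\<sigma>\<close>.
\<close>

lemma analytic_component_power_series: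
  fixes w :: "real \<times> real \<Rightarrow> real ^ 'n"
  assumes "real_analytic_on2 w U" "(0, 0) \<in> U"
  obtains \<rho> c where "0 < \<rho>" "\<And>i. coeff_summable (c i) \<rho>"
    "\<And>i z. norm z \<le> \<rho> \<Longrightarrow> w z $ i = power_series2 (c i) z"
proof -
  obtain \<sigma> and C :: "nat \<Rightarrow> nat \<Rightarrow> real ^ 'n" where \<sigma>: "0 < \<sigma>" and
    C: "\<forall>(x, y)\<in>ball (0, 0) \<sigma>. ((\<lambda>(i, j). ((x - 0) ^ i * (y - 0) ^ j) *\<^sub>R C i j) has_sum w (x, y)) UNIV"
    using bspec[OF assms(1)[unfolded real_analytic_on2_def] assms(2)]
    unfolding prod.case by (elim exE conjE) (rule that)
  have sum: "((\<lambda>(j, k). C j k $ i * fst z ^ j * snd z ^ k) has_sum w z $ i) UNIV"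
    if "norm z < \<sigma>" for z i
  proof -
    have "z \<in> ball (0, 0) \<sigma>" using that by (simp add: zero_prod_def[symmetric])
    from bspec[OF C this]
    have "((\<lambda>(j, k). (fst z ^ j * snd z ^ k) *\<^sub>R C j k) has_sum w z) UNIV"
      by (simp add: case_prod_unfold)
    from has_sum_bounded_linear[OF bounded_linear_vec_nth[of i] this] show ?thesis
      by (simp add: case_prod_unfold mult_ac)
  qed
  show thesis
  proof (rule that[of "\<sigma> / 3" "\<lambda>i j k. C j k $ i"])
    show "0 < \<sigma> / 3" using \<sigma> by simp
    fix i
    show "w z $ i = power_series2 (\<lambda>j k. C j k $ i) z" if "norm z \<le> \<sigma> / 3" for z
      unfolding power_series2_def using infsumI[OF sum[of z i]] that \<sigma> by simp
    have "norm (\<sigma> / 3, \<sigma> / 3) < \<sigma>"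
      using norm_Pair_le[of "\<sigma> / 3" "\<sigma> / 3"] \<sigma> by simp
    from sum[OF this, of i]
    have "(\<lambda>(j, k). C j k $ i * (\<sigma> / 3) ^ j * (\<sigma> / 3) ^ k) summable_on UNIV"
      by (auto simp: summable_on_def)
    then have "(\<lambda>p. norm (case p of (j, k) \<Rightarrow> C j k $ i * (\<sigma> / 3) ^ j * (\<sigma> / 3) ^ k)) summable_on UNIV"
      by (rule summable_on_iff_abs_summable_on_real[THEN iffD1])
    moreover have "norm (case p of (j, k) \<Rightarrow> C j k $ i * (\<sigma> / 3) ^ j * (\<sigma> / 3) ^ k)
        = (case p of (j, k) \<Rightarrow> \<bar>C j k $ i\<bar> * (\<sigma> / 3) ^ (j + k))" for p
      using \<sigma> by (cases p) (simp add: abs_mult power_add)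
    ultimately show "coeff_summable (\<lambda>j k. C j k $ i) (\<sigma> / 3)"
      unfolding coeff_summable_def by simp
  qed
qed

section \<open>Differentiable germs of prescribed order\<close>

text \<open>
  Germs at the origin that vanish to order \<open>m\<close> together with the matching bound on the derivative.
  A plain Landau bound would not survive the two differentiations along the field.  For \<open>m = 0\<close> the
  truncated exponent \<open>m - 1 = 0\<close> asks for bounded derivatives, so that constants belong to order
  zero and orders simply add under multiplication.
\<close>

definition C1_order :: "nat \<Rightarrow> (real \<times> real \<Rightarrow> real) \<Rightarrow> bool" where
  "C1_order m g \<longleftrightarrow> (\<exists>G K. 0 \<le> K \<and> (\<forall>\<^sub>F z in nhds 0. (g has_derivative G z) (at z) \<and>
     \<bar>g z\<bar> \<le> K * norm z ^ m \<and> (\<forall>h. \<bar>G z h\<bar> \<le> K * norm z ^ (m - 1) * norm h)))"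

lemma C1_orderE:
  assumes "C1_order m g"
  obtains G K where "0 \<le> K" "\<forall>\<^sub>F z in nhds 0. (g has_derivative G z) (at z) \<and>
     \<bar>g z\<bar> \<le> K * norm z ^ m \<and> (\<forall>h. \<bar>G z h\<bar> \<le> K * norm z ^ (m - 1) * norm h)"
  using assms unfolding C1_order_def by blast

lemma C1_order_cong:
  assumes "C1_order m f" "\<forall>\<^sub>F z in nhds 0. f z = g z"
  shows "C1_order m g"
proof -
  obtain G K where K: "0 \<le> K" and ev: "\<forall>\<^sub>F z in nhds 0. (f has_derivative G z) (at z) \<and>
     \<bar>f z\<bar> \<le> K * norm z ^ m \<and> (\<forall>h. \<bar>G z h\<bar> \<le> K * norm z ^ (m - 1) * norm h)"
    using assms(1) by (rule C1_orderE)
  obtain U where U: "open U" "0 \<in> U" "\<And>z. z \<in> U \<Longrightarrow> f z = g z"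
    using assms(2) unfolding eventually_nhds by blast
  have "\<forall>\<^sub>F z in nhds 0. z \<in> U"
    using U by (auto simp: eventually_nhds)
  with ev have "\<forall>\<^sub>F z in nhds 0. (g has_derivative G z) (at z) \<and>
     \<bar>g z\<bar> \<le> K * norm z ^ m \<and> (\<forall>h. \<bar>G z h\<bar> \<le> K * norm z ^ (m - 1) * norm h)"
  proof eventually_elim
    case (elim z)
    then show ?case
      using has_derivative_transform_within_open[of f "G z" z UNIV U g] U by auto
  qed
  with K show ?thesis unfolding C1_order_def by blast
qed

lemma C1_order_mono:
  assumes "C1_order m g" "m' \<le> m"
  shows "C1_order m' g"
proof -
  obtain G K where K: "0 \<le> K" and ev: "\<forall>\<^sub>F z in nhds 0. (g has_derivative G z) (at z) \<and>
     \<bar>g z\<bar> \<le> K * norm z ^ m \<and> (\<forall>h. \<bar>G z h\<bar> \<le> K * norm z ^ (m - 1) * norm h)"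
    using assms(1) by (rule C1_orderE)
  from ev eventually_norm_less[OF zero_less_one]
  have "\<forall>\<^sub>F z in nhds 0. (g has_derivative G z) (at z) \<and>
     \<bar>g z\<bar> \<le> K * norm z ^ m' \<and> (\<forall>h. \<bar>G z h\<bar> \<le> K * norm z ^ (m' - 1) * norm h)"
  proof eventually_elim
    case (elim z)
    have "norm z ^ m \<le> norm z ^ m'" "norm z ^ (m - 1) \<le> norm z ^ (m' - 1)"
      using elim assms(2) by (auto intro!: power_decreasing)
    then have "K * norm z ^ m \<le> K * norm z ^ m'"
      and "K * norm z ^ (m - 1) * norm h \<le> K * norm z ^ (m' - 1) * norm h" for h :: "real \<times> real"
      using K by (auto intro!: mult_left_mono mult_right_mono)
    with elim show ?case by (meson order.trans)
  qed
  with K show ?thesis unfolding C1_order_def by blast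
qed

lemma C1_order_const: "C1_order 0 (\<lambda>_. a)"
  unfolding C1_order_def
  by (intro exI[of _ "\<lambda>_ _. 0"] exI[of _ "\<bar>a\<bar>"]) (auto intro!: always_eventually)

lemma C1_order_zero: "C1_order m (\<lambda>_. 0)"
  unfolding C1_order_def
  by (intro exI[of _ "\<lambda>_ _. 0"] exI[of _ 0]) (auto intro!: always_eventually)

lemma C1_order_fst: "C1_order 1 fst" and C1_order_snd: "C1_order 1 snd"
  unfolding C1_order_def
  by (intro exI[of _ "\<lambda>_. fst"] exI[of _ "\<lambda>_. snd"] exI[of _ 1];
      auto intro!: always_eventually derivative_eq_intros simp: abs_fst_le_norm abs_snd_le_norm)+

lemma C1_order_add:
  assumes "C1_order m f" "C1_order m g"
  shows "C1_order m (\<lambda>z. f z + g z)"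
proof -
  obtain F K where K: "0 \<le> K" and f: "\<forall>\<^sub>F z in nhds 0. (f has_derivative F z) (at z) \<and>
     \<bar>f z\<bar> \<le> K * norm z ^ m \<and> (\<forall>h. \<bar>F z h\<bar> \<le> K * norm z ^ (m - 1) * norm h)"
    using assms(1) by (rule C1_orderE)
  obtain G L where L: "0 \<le> L" and g: "\<forall>\<^sub>F z in nhds 0. (g has_derivative G z) (at z) \<and>
     \<bar>g z\<bar> \<le> L * norm z ^ m \<and> (\<forall>h. \<bar>G z h\<bar> \<le> L * norm z ^ (m - 1) * norm h)"
    using assms(2) by (rule C1_orderE)
  from f g have "\<forall>\<^sub>F z in nhds 0. ((\<lambda>z. f z + g z) has_derivative (\<lambda>h. F z h + G z h)) (at z) \<and>
     \<bar>f z + g z\<bar> \<le> (K + L) * norm z ^ m \<and>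
     (\<forall>h. \<bar>F z h + G z h\<bar> \<le> (K + L) * norm z ^ (m - 1) * norm h)"
  proof eventually_elim
    case (elim z)
    have "\<bar>F z h + G z h\<bar> \<le> K * norm z ^ (m - 1) * norm h + L * norm z ^ (m - 1) * norm h" for h
      using elim by (meson abs_triangle_ineq add_mono order.trans)
    moreover have "\<bar>f z + g z\<bar> \<le> K * norm z ^ m + L * norm z ^ m"
      using elim by (meson abs_triangle_ineq add_mono order.trans)
    ultimately show ?case
      using elim by (auto intro: has_derivative_add simp: distrib_right)
  qed
  with K L show ?thesis
    unfolding C1_order_def
    by (intro exI[of _ "\<lambda>z h. F z h + G z h"] exI[of _ "K + L"]) auto
qed

lemma C1_order_mult:
  assumes "C1_order m f" "C1_order n g"
  shows "C1_order (m + n) (\<lambda>z. f z * g z)"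
proof -
  obtain F K where K: "0 \<le> K" and f: "\<forall>\<^sub>F z in nhds 0. (f has_derivative F z) (at z) \<and>
     \<bar>f z\<bar> \<le> K * norm z ^ m \<and> (\<forall>h. \<bar>F z h\<bar> \<le> K * norm z ^ (m - 1) * norm h)"
    using assms(1) by (rule C1_orderE)
  obtain G L where L: "0 \<le> L" and g: "\<forall>\<^sub>F z in nhds 0. (g has_derivative G z) (at z) \<and>
     \<bar>g z\<bar> \<le> L * norm z ^ n \<and> (\<forall>h. \<bar>G z h\<bar> \<le> L * norm z ^ (n - 1) * norm h)"
    using assms(2) by (rule C1_orderE)
  from f g eventually_norm_less[OF zero_less_one]
  have "\<forall>\<^sub>F z in nhds 0. ((\<lambda>z. f z * g z) has_derivative (\<lambda>h. f z * G z h + F z h * g z)) (at z) \<and>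
     \<bar>f z * g z\<bar> \<le> (2 * (K * L)) * norm z ^ (m + n) \<and>
     (\<forall>h. \<bar>f z * G z h + F z h * g z\<bar> \<le> (2 * (K * L)) * norm z ^ (m + n - 1) * norm h)"
  proof eventually_elim
    case (elim z)
    let ?N = "norm z"
    have "\<bar>f z * g z\<bar> \<le> (K * ?N ^ m) * (L * ?N ^ n)"
      unfolding abs_mult using elim K by (intro mult_mono) auto
    also have "\<dots> = K * L * ?N ^ (m + n)" by (simp add: power_add)
    also have "\<dots> \<le> (2 * (K * L)) * ?N ^ (m + n)"
      using K L by (intro mult_right_mono) auto
    finally have 1: "\<bar>f z * g z\<bar> \<le> (2 * (K * L)) * ?N ^ (m + n)" .
    have 2: "\<bar>f z * G z h + F z h * g z\<bar> \<le> (2 * (K * L)) * ?N ^ (m + n - 1) * norm h" for h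
    proof -
      have Fh: "\<bar>F z h\<bar> \<le> K * ?N ^ (m - 1) * norm h" and Gh: "\<bar>G z h\<bar> \<le> L * ?N ^ (n - 1) * norm h"
        using elim by blast+
      have "\<bar>f z * G z h\<bar> \<le> (K * ?N ^ m) * (L * ?N ^ (n - 1) * norm h)"
        unfolding abs_mult using elim K Gh by (intro mult_mono) auto
      also have "\<dots> = K * L * norm h * ?N ^ (m + (n - 1))" by (simp add: power_add)
      also have "\<dots> \<le> K * L * norm h * ?N ^ (m + n - 1)"
        using elim K L by (intro mult_left_mono power_decreasing) auto
      finally have a: "\<bar>f z * G z h\<bar> \<le> K * L * norm h * ?N ^ (m + n - 1)" .
      have "\<bar>F z h * g z\<bar> \<le> (K * ?N ^ (m - 1) * norm h) * (L * ?N ^ n)"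
        unfolding abs_mult using elim K Fh by (intro mult_mono) auto
      also have "\<dots> = K * L * norm h * ?N ^ (m - 1 + n)" by (simp add: power_add)
      also have "\<dots> \<le> K * L * norm h * ?N ^ (m + n - 1)"
        using elim K L by (intro mult_left_mono power_decreasing) auto
      finally have b: "\<bar>F z h * g z\<bar> \<le> K * L * norm h * ?N ^ (m + n - 1)" .
      from a b show ?thesis
        using abs_triangle_ineq[of "f z * G z h" "F z h * g z"] by (simp add: mult_ac)
    qed
    show ?case using elim 1 2 by (auto intro: has_derivative_mult)
  qed
  with K L show ?thesis
    unfolding C1_order_def
    by (intro exI[of _ "\<lambda>z h. f z * G z h + F z h * g z"] exI[of _ "2 * (K * L)"]) auto
qed

lemma C1_order_cmult: "C1_order m g \<Longrightarrow> C1_order m (\<lambda>z. a * g z)"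
  using C1_order_mult[OF C1_order_const[of a], of m g] by simp

lemma C1_order_diff: "C1_order m f \<Longrightarrow> C1_order m g \<Longrightarrow> C1_order m (\<lambda>z. f z - g z)"
  using C1_order_add[of m f "\<lambda>z. - 1 * g z"] C1_order_cmult[of m g "- 1"] by simp

lemma C1_order_power: "C1_order m g \<Longrightarrow> C1_order (m * k) (\<lambda>z. g z ^ k)"
  by (induction k) (auto intro: C1_order_const C1_order_mult)

lemma C1_order_sum: "(\<And>i. i \<in> A \<Longrightarrow> C1_order m (f i)) \<Longrightarrow> C1_order m (\<lambda>z. \<Sum>i\<in>A. f i z)"
  by (induction A rule: infinite_finite_induct) (auto intro: C1_order_zero C1_order_add)

lemma C1_order_prod:
  "(\<And>i. i \<in> A \<Longrightarrow> C1_order (m i) (f i)) \<Longrightarrow> C1_order (\<Sum>i\<in>A. m i) (\<lambda>z. \<Prod>i\<in>A. f i z)"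
  by (induction A rule: infinite_finite_induct) (auto intro: C1_order_const C1_order_mult)

text \<open>
  The coefficients of the partial derivatives vanish below degree \<open>m - 1\<close>, so the same estimate
  applies to them on a slightly smaller disc.
\<close>

lemma C1_order_power_series2:
  assumes "coeff_summable c \<rho>" "0 < \<rho>" "\<And>i j. i + j < m \<Longrightarrow> c i j = 0"
  shows "C1_order m (power_series2 c)"
proof -
  define \<sigma> where "\<sigma> = \<rho> / 2"
  have \<sigma>: "0 < \<sigma>" "\<sigma> < \<rho>" using assms(2) by (auto simp: \<sigma>_def)
  obtain K where K: "0 \<le> K" "\<And>z. norm z \<le> \<rho> \<Longrightarrow> \<bar>power_series2 c z\<bar> \<le> K * norm z ^ m"
    using power_series2_bound[OF assms] by blast
  obtain L where L: "0 \<le> L"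
    "\<And>z. norm z \<le> \<sigma> \<Longrightarrow> \<bar>power_series2 (coeff_dx c) z\<bar> \<le> L * norm z ^ (m - 1)"
    using power_series2_bound[OF coeff_summable_dx[OF assms(1) \<sigma>] \<sigma>(1), of "m - 1"] assms(3)
    by (auto simp: coeff_dx_def)
  obtain M where M: "0 \<le> M"
    "\<And>z. norm z \<le> \<sigma> \<Longrightarrow> \<bar>power_series2 (coeff_dy c) z\<bar> \<le> M * norm z ^ (m - 1)"
    using power_series2_bound[OF coeff_summable_dy[OF assms(1) \<sigma>] \<sigma>(1), of "m - 1"] assms(3)
    by (auto simp: coeff_dy_def)
  let ?G = "\<lambda>z h. fst h * power_series2 (coeff_dx c) z + snd h * power_series2 (coeff_dy c) z"
  have "(power_series2 c has_derivative ?G z) (at z) \<and> \<bar>power_series2 c z\<bar> \<le> (K + L + M) * norm z ^ m \<and>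
      (\<forall>h. \<bar>?G z h\<bar> \<le> (K + L + M) * norm z ^ (m - 1) * norm h)" if z: "norm z < \<sigma>" for z
  proof (intro conjI allI)
    show "(power_series2 c has_derivative ?G z) (at z)"
      using power_series2_has_derivative[OF assms(1) \<sigma> z] .
    have "K * norm z ^ m \<le> (K + L + M) * norm z ^ m"
      using L M by (intro mult_right_mono) auto
    then show "\<bar>power_series2 c z\<bar> \<le> (K + L + M) * norm z ^ m"
      using K(2)[of z] z \<sigma> by linarith
    fix h :: "real \<times> real"
    have "\<bar>?G z h\<bar> \<le> (L * norm z ^ (m - 1) + M * norm z ^ (m - 1)) * norm h"
      using L(2)[of z] M(2)[of z] z by (intro abs_linear_form_le) auto
    also have "\<dots> \<le> (K + L + M) * norm z ^ (m - 1) * norm h"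
      using K(1) by (intro mult_right_mono) (auto simp: distrib_right)
    finally show "\<bar>?G z h\<bar> \<le> (K + L + M) * norm z ^ (m - 1) * norm h" .
  qed
  moreover have "\<forall>\<^sub>F z in nhds (0 :: real \<times> real). norm z < \<sigma>"
    using \<sigma>(1) by (rule eventually_norm_less)
  ultimately have "\<forall>\<^sub>F z in nhds 0. (power_series2 c has_derivative ?G z) (at z) \<and> \<bar>power_series2 c z\<bar> \<le> (K + L + M) * norm z ^ m \<and>
      (\<forall>h. \<bar>?G z h\<bar> \<le> (K + L + M) * norm z ^ (m - 1) * norm h)"
    by (auto elim: eventually_mono)
  then show ?thesis
    unfolding C1_order_def using K(1) L(1) M(1)
    by (intro exI[of _ ?G] exI[of _ "K + L + M"]) auto
qed

lemma C1_order_power_series2_tail: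
  assumes "coeff_summable c \<rho>" "0 < \<rho>"
  shows "C1_order m (power_series2 (coeff_tail m c))"
  using coeff_summable_tail[OF assms] assms(2)
  by (rule C1_order_power_series2) (simp add: coeff_tail_def)

lemma C1_order_imp_bigo:
  assumes "C1_order m g"
  shows "g \<in> O[nhds 0](\<lambda>z. norm z ^ m)"
proof -
  obtain G K where "\<forall>\<^sub>F z in nhds 0. (g has_derivative G z) (at z) \<and>
     \<bar>g z\<bar> \<le> K * norm z ^ m \<and> (\<forall>h. \<bar>G z h\<bar> \<le> K * norm z ^ (m - 1) * norm h)"
    using assms by (rule C1_orderE)
  then show ?thesis
    by (intro bigoI[of _ K]) (auto elim: eventually_mono)
qed

section \<open>Quadratic forms along the oscillator field\<close>

definition quad_form :: "real \<Rightarrow> real \<Rightarrow> real \<Rightarrow> real \<times> real \<Rightarrow> real" where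
  "quad_form a b c z = a * (fst z)\<^sup>2 + b * (fst z * snd z) + c * (snd z)\<^sup>2"

text \<open>
  Along a ray \<open>t v\<close> a quadratic form scales like \<open>t\<^sup>2\<close>, which a bound of order \<open>t\<^sup>3\<close> only permits if
  its value at \<open>v\<close> is zero.  The directions \<open>(1, 0)\<close>, \<open>(0, 1)\<close> and \<open>(1, 1)\<close> recover the
  coefficients.
\<close>

lemma quad_form_eq_zero:
  assumes "\<forall>\<^sub>F z in nhds 0. \<bar>quad_form a b c z\<bar> \<le> K * norm z ^ 3"
  shows "a = 0" "b = 0" "c = 0"
proof -
  obtain d where d: "0 < d" "\<And>z. norm z < d \<Longrightarrow> \<bar>quad_form a b c z\<bar> \<le> K * norm z ^ 3"
    using assms unfolding eventually_nhds_metric by (auto simp: dist_norm)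
  \<comment> \<open>The radius \<open>2\<close> covers the three test directions; \<open>t < d / 2\<close> then keeps \<open>t v\<close> in the disc.\<close>
  have zero: "quad_form a b c v = 0" if v: "norm v \<le> 2" for v
  proof -
    have "\<forall>\<^sub>F t in at_right 0. \<bar>quad_form a b c v\<bar> \<le> t * (K * norm v ^ 3)"
      unfolding eventually_at_right_field
    proof (intro exI[of _ "d / 2"] conjI allI impI)
      fix t :: real assume t: "0 < t" "t < d / 2"
      have "t * norm v \<le> t * 2" using t v by (intro mult_left_mono) auto
      moreover have "norm (t *\<^sub>R v) = t * norm v" using t by simp
      ultimately have "norm (t *\<^sub>R v) < d" using t by linarith
      then have "\<bar>quad_form a b c (t *\<^sub>R v)\<bar> \<le> K * norm (t *\<^sub>R v) ^ 3"
        by (rule d(2))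
      moreover have "quad_form a b c (t *\<^sub>R v) = t\<^sup>2 * quad_form a b c v"
        by (simp add: quad_form_def power2_eq_square algebra_simps)
      ultimately have "t\<^sup>2 * \<bar>quad_form a b c v\<bar> \<le> t\<^sup>2 * (t * (K * norm v ^ 3))"
        using t by (simp add: abs_mult power_mult_distrib power2_eq_square power3_eq_cube mult_ac)
      then show "\<bar>quad_form a b c v\<bar> \<le> t * (K * norm v ^ 3)"
        by (rule mult_left_le_imp_le) (use t in simp)
    qed (use d in simp)
    moreover have "((\<lambda>t. t * (K * norm v ^ 3)) \<longlongrightarrow> 0 * (K * norm v ^ 3)) (at_right 0)"
      by (intro tendsto_intros)
    ultimately have "\<bar>quad_form a b c v\<bar> \<le> 0 * (K * norm v ^ 3)"
      by (intro tendsto_lowerbound[of _ _ "at_right 0"]) auto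
    then show ?thesis by simp
  qed
  have "norm (1::real, 1::real) \<le> 2"
    using norm_Pair_le[of "1::real" "1::real"] by simp
  then show "a = 0" "b = 0" "c = 0"
    using zero[of "(1, 0)"] zero[of "(0, 1)"] zero[of "(1, 1)"]
    by (simp_all add: quad_form_def norm_Pair)
qed

text \<open>
  The linear part of the field maps the quadratic form to a quadratic form.  The correction
  \<open>- \<rho>\<close> to the acceleration multiplies a linear form, and the derivative of \<open>e\<close>, of order two, is
  applied to a field of order one; both contributions are of order three.
\<close>

lemma quad_form_along_field:
  assumes "C1_order 3 e" "C1_order 2 \<rho>"
    and g: "\<forall>\<^sub>F z in nhds 0. g z = quad_form a b c z + e z"
  obtains G K where "\<forall>\<^sub>F z in nhds 0. (g has_derivative G z) (at z) \<and>
    \<bar>G z (snd z, - (\<omega>\<^sup>2 * fst z + \<rho> z)) - quad_form (- \<omega>\<^sup>2 * b) (2 * a - 2 * \<omega>\<^sup>2 * c) b z\<bar>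
      \<le> K * norm z ^ 3"
proof -
  obtain E K where K: "0 \<le> K" and e: "\<forall>\<^sub>F z in nhds 0. (e has_derivative E z) (at z) \<and>
     \<bar>e z\<bar> \<le> K * norm z ^ 3 \<and> (\<forall>h. \<bar>E z h\<bar> \<le> K * norm z ^ (3 - 1) * norm h)"
    using assms(1) by (rule C1_orderE)
  obtain P L where L: "0 \<le> L" and \<rho>: "\<forall>\<^sub>F z in nhds 0. (\<rho> has_derivative P z) (at z) \<and>
     \<bar>\<rho> z\<bar> \<le> L * norm z ^ 2 \<and> (\<forall>h. \<bar>P z h\<bar> \<le> L * norm z ^ (2 - 1) * norm h)"
    using assms(2) by (rule C1_orderE)
  define G where "G = (\<lambda>z h. fst h * (2 * a * fst z + b * snd z)
     + snd h * (b * fst z + 2 * c * snd z) + E z h)"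
  obtain U where U: "open U" "0 \<in> U" "\<And>z. z \<in> U \<Longrightarrow> g z = quad_form a b c z + e z"
    using g unfolding eventually_nhds by blast
  have "\<forall>\<^sub>F z in nhds 0. z \<in> U"
    using U by (auto simp: eventually_nhds)
  with e \<rho> eventually_norm_less[OF zero_less_one]
  have "\<forall>\<^sub>F z in nhds 0. (g has_derivative G z) (at z) \<and>
    \<bar>G z (snd z, - (\<omega>\<^sup>2 * fst z + \<rho> z)) - quad_form (- \<omega>\<^sup>2 * b) (2 * a - 2 * \<omega>\<^sup>2 * c) b z\<bar>
      \<le> ((\<bar>b\<bar> + 2 * \<bar>c\<bar>) * L + K * (1 + \<omega>\<^sup>2 + L)) * norm z ^ 3"
  proof eventually_elim
    case (elim z)
    let ?N = "norm z" and ?V = "(snd z, - (\<omega>\<^sup>2 * fst z + \<rho> z))"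
    have "((\<lambda>z. quad_form a b c z + e z) has_derivative G z) (at z)"
      unfolding quad_form_def G_def using elim
      by (auto intro!: derivative_eq_intros simp: algebra_simps power2_eq_square)
    then have "(g has_derivative G z) (at z)"
      using has_derivative_transform_within_open[of _ "G z" z UNIV U g] U elim by auto
    moreover have "\<bar>G z ?V - quad_form (- \<omega>\<^sup>2 * b) (2 * a - 2 * \<omega>\<^sup>2 * c) b z\<bar>
      \<le> ((\<bar>b\<bar> + 2 * \<bar>c\<bar>) * L + K * (1 + \<omega>\<^sup>2 + L)) * ?N ^ 3"
    proof -
      have N2: "?N ^ 2 \<le> ?N"
        using elim by (simp add: power2_eq_square mult_left_le_one_le)
      have rho: "\<bar>\<rho> z\<bar> \<le> L * ?N ^ 2" using elim by blast
      have "\<bar>\<omega>\<^sup>2 * fst z\<bar> \<le> \<omega>\<^sup>2 * ?N"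
        by (simp add: abs_mult abs_fst_le_norm mult_left_mono)
      moreover have "\<bar>\<rho> z\<bar> \<le> L * ?N"
        using rho mult_left_mono[OF N2 L] by linarith
      moreover have "norm ?V \<le> \<bar>snd z\<bar> + \<bar>- (\<omega>\<^sup>2 * fst z + \<rho> z)\<bar>"
        using norm_Pair_le[of "snd z" "- (\<omega>\<^sup>2 * fst z + \<rho> z)"] by simp
      moreover have "(1 + \<omega>\<^sup>2 + L) * ?N = ?N + \<omega>\<^sup>2 * ?N + L * ?N"
        by (simp add: distrib_right)
      ultimately have V: "norm ?V \<le> (1 + \<omega>\<^sup>2 + L) * ?N"
        using abs_snd_le_norm[of z] abs_triangle_ineq[of "\<omega>\<^sup>2 * fst z" "\<rho> z"] by linarith
      have "\<bar>E z ?V\<bar> \<le> K * ?N ^ (3 - 1) * norm ?V"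
        using elim by blast
      also have "\<dots> \<le> K * ?N ^ (3 - 1) * ((1 + \<omega>\<^sup>2 + L) * ?N)"
        using V K by (intro mult_left_mono) auto
      finally have E: "\<bar>E z ?V\<bar> \<le> K * (1 + \<omega>\<^sup>2 + L) * ?N ^ 3"
        by (simp add: power2_eq_square power3_eq_cube mult_ac)
      have "\<bar>fst z * b + snd z * (2 * c)\<bar> \<le> (\<bar>b\<bar> + 2 * \<bar>c\<bar>) * ?N"
        by (intro abs_linear_form_le) auto
      then have "\<bar>(fst z * b + snd z * (2 * c)) * \<rho> z\<bar> \<le> ((\<bar>b\<bar> + 2 * \<bar>c\<bar>) * ?N) * (L * ?N ^ 2)"
        unfolding abs_mult using rho by (intro mult_mono) auto
      then have "\<bar>(fst z * b + snd z * (2 * c)) * \<rho> z\<bar> \<le> (\<bar>b\<bar> + 2 * \<bar>c\<bar>) * L * ?N ^ 3"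
        by (simp add: power2_eq_square power3_eq_cube mult_ac)
      moreover have "G z ?V - quad_form (- \<omega>\<^sup>2 * b) (2 * a - 2 * \<omega>\<^sup>2 * c) b z
          = E z ?V - (fst z * b + snd z * (2 * c)) * \<rho> z"
        by (simp add: G_def quad_form_def algebra_simps power2_eq_square)
      ultimately show ?thesis
        using E abs_triangle_ineq4[of "E z ?V" "(fst z * b + snd z * (2 * c)) * \<rho> z"]
        by (simp add: distrib_right)
    qed
    ultimately show ?case by blast
  qed
  then show thesis by (rule that)
qed

text \<open>
  The first differentiation of a power series \<open>q + \<dots>\<close> along the field.  Its remainder is to be
  differentiated again, so a mere bound of order three would not do.  That the partial derivatives
  are themselves power series makes the remainder a \<open>C1_order\<close> germ.
\<close>

lemma power_series2_along_field:
  assumes c: "coeff_summable c \<sigma>" "0 < \<sigma>" "c 0 0 = 0" "c 1 0 = 0" "c 0 1 = 0" and \<rho>: "C1_order 2 \<rho>"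
  obtains e where "C1_order 3 e"
    "\<forall>\<^sub>F z in nhds 0. snd z * power_series2 (coeff_dx c) z
       + - (\<omega>\<^sup>2 * fst z + \<rho> z) * power_series2 (coeff_dy c) z
     = quad_form (- \<omega>\<^sup>2 * c 1 1) (2 * c 2 0 - 2 * \<omega>\<^sup>2 * c 0 2) (c 1 1) z + e z"
proof -
  define \<tau> where "\<tau> = \<sigma> / 2"
  have \<tau>: "0 < \<tau>" "\<tau> < \<sigma>" using c(2) by (auto simp: \<tau>_def)
  define ex where "ex = power_series2 (coeff_tail 2 (coeff_dx c))"
  have ex: "C1_order 2 ex" "\<And>z. norm z \<le> \<tau> \<Longrightarrow> power_series2 (coeff_dx c) z =
      (\<Sum>i<2. \<Sum>j<2 - i. coeff_dx c i j * fst z ^ i * snd z ^ j) + ex z"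
    unfolding ex_def using coeff_summable_dx[OF c(1) \<tau>] \<tau>(1)
    by (rule C1_order_power_series2_tail power_series2_split)+
  define ey where "ey = power_series2 (coeff_tail 2 (coeff_dy c))"
  have ey: "C1_order 2 ey" "\<And>z. norm z \<le> \<tau> \<Longrightarrow> power_series2 (coeff_dy c) z =
      (\<Sum>i<2. \<Sum>j<2 - i. coeff_dy c i j * fst z ^ i * snd z ^ j) + ey z"
    unfolding ey_def using coeff_summable_dy[OF c(1) \<tau>] \<tau>(1)
    by (rule C1_order_power_series2_tail power_series2_split)+
  define e where "e = (\<lambda>z. snd z * ex z + (- \<omega>\<^sup>2) * (fst z * ey z)
     - \<rho> z * ((c 1 1 * fst z + (2 * c 0 2) * snd z) + ey z))"
  have "C1_order (1 + 2) (\<lambda>z. snd z * ex z + (- \<omega>\<^sup>2) * (fst z * ey z))"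
    by (intro C1_order_add C1_order_cmult C1_order_mult C1_order_fst C1_order_snd ex ey)
  moreover have "C1_order (2 + 1) (\<lambda>z. \<rho> z * ((c 1 1 * fst z + (2 * c 0 2) * snd z) + ey z))"
    by (intro C1_order_mult \<rho> C1_order_add C1_order_cmult C1_order_fst C1_order_snd
        C1_order_mono[OF ey(1)]) simp
  ultimately have "C1_order 3 e"
    unfolding e_def by (intro C1_order_diff) (simp_all add: eval_nat_numeral)
  moreover from eventually_norm_less[OF \<tau>(1)] have "\<forall>\<^sub>F z in nhds 0. snd z * power_series2 (coeff_dx c) z
       + - (\<omega>\<^sup>2 * fst z + \<rho> z) * power_series2 (coeff_dy c) z
     = quad_form (- \<omega>\<^sup>2 * c 1 1) (2 * c 2 0 - 2 * \<omega>\<^sup>2 * c 0 2) (c 1 1) z + e z"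
  proof eventually_elim
    case (elim z)
    have "power_series2 (coeff_dx c) z = 2 * c 2 0 * fst z + c 1 1 * snd z + ex z"
      using ex(2)[OF less_imp_le[OF elim]] c by (simp add: coeff_dx_def numeral_2_eq_2)
    moreover have "power_series2 (coeff_dy c) z = c 1 1 * fst z + 2 * c 0 2 * snd z + ey z"
      using ey(2)[OF less_imp_le[OF elim]] c by (simp add: coeff_dy_def numeral_2_eq_2)
    ultimately show ?case
      by (simp add: e_def quad_form_def power2_eq_square) (simp add: algebra_simps)
  qed
  ultimately show thesis by (rule that)
qed

section \<open>Polynomial nonlinearities on a graph of second order\<close>

lemma mi_order_zero_iff: "mi_order k = 0 \<longleftrightarrow> k = 0"
  by (simp add: mi_order_def vec_eq_iff)

lemma mi_order_axis: "mi_order (axis i 1) = 1"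
  by (simp add: mi_order_def axis_def)

lemma mi_order_eq_one:
  assumes "mi_order k = 1"
  shows "\<exists>i. k = axis i 1"
proof -
  have "(\<Sum>i\<in>UNIV. k $ i) = 1" using assms by (simp add: mi_order_def)
  then obtain i where "k $ i = 1" "\<And>j. j \<noteq> i \<Longrightarrow> k $ j = 0"
    using sum_eq_1_iff[of UNIV "\<lambda>i. k $ i"] by auto
  then have "k = axis i 1" by (auto simp: vec_eq_iff axis_def)
  then show ?thesis ..
qed

lemma mi_power_zero: "mi_power \<eta> 0 = 1"
  by (simp add: mi_power_def)

lemma mi_power_axis: "mi_power \<eta> (axis i 1) = \<eta> $ i"
proof -
  have "mi_power \<eta> (axis i 1) = (\<Prod>j\<in>UNIV. if j = i then \<eta> $ j else 1)"
    unfolding mi_power_def by (intro prod.cong) (auto simp: axis_def)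
  then show ?thesis by simp
qed

definition mi_range :: "nat \<Rightarrow> (nat \<times> (nat ^ 'n)) set" where
  "mi_range l = {(j, k). 2 \<le> j + mi_order k \<and> j + mi_order k \<le> l}"

lemma finite_mi_range: "finite (mi_range l :: (nat \<times> (nat ^ 'n)) set)"
proof -
  have "finite {f :: 'n \<Rightarrow> nat. \<forall>i. f i \<in> {..l}}"
    using finite_PiE[of "UNIV :: 'n set" "\<lambda>_. {..l}"] by (simp add: PiE_UNIV_domain Pi_def)
  then have "finite (vec_lambda ` {f :: 'n \<Rightarrow> nat. \<forall>i. f i \<in> {..l}})"
    by (rule finite_imageI)
  moreover have "{k :: nat ^ 'n. mi_order k \<le> l} \<subseteq> vec_lambda ` {f. \<forall>i. f i \<in> {..l}}"
  proof
    fix k :: "nat ^ 'n" assume "k \<in> {k. mi_order k \<le> l}"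
    then have "k $ i \<le> l" for i
      using member_le_sum[of i UNIV "\<lambda>i. k $ i"] by (simp add: mi_order_def)
    then have "($) k \<in> {f. \<forall>i. f i \<in> {..l}}" by simp
    then show "k \<in> vec_lambda ` {f. \<forall>i. f i \<in> {..l}}"
      by (metis (no_types, lifting) image_eqI vec_nth_inverse)
  qed
  ultimately have "finite {k :: nat ^ 'n. mi_order k \<le> l}"
    by (rule finite_subset[rotated])
  then have "finite ({..l} \<times> {k :: nat ^ 'n. mi_order k \<le> l})" by simp
  then show ?thesis
    by (rule finite_subset[rotated]) (auto simp: mi_range_def)
qed

lemma nonlinearity_mono:
  fixes c :: "nat \<Rightarrow> nat ^ 'n \<Rightarrow> 'b::real_vector"
  assumes "l \<le> l'" "\<And>j k. l < j + mi_order k \<Longrightarrow> c j k = 0"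
  shows "nonlinearity l c = nonlinearity l' c"
proof (intro ext)
  fix x and \<eta> :: "real ^ 'n"
  have le: "j + mi_order k \<le> l" if "c j k \<noteq> 0" for j k
    using assms(2)[of j k] that by (rule_tac ccontr) simp
  show "nonlinearity l c x \<eta> = nonlinearity l' c x \<eta>"
    unfolding nonlinearity_def mi_range_def[symmetric]
    by (rule sum.mono_neutral_left[OF finite_mi_range]) (use assms(1) in \<open>auto simp: mi_range_def dest: le\<close>)
qed

lemma nonlinearity_component: "nonlinearity l s x \<eta> $ i = nonlinearity l (\<lambda>j k. s j k $ i) x \<eta>"
  by (simp add: nonlinearity_def case_prod_unfold)

lemma C1_order_monomial:
  assumes "\<And>i. C1_order 2 (\<lambda>z. w z $ i)"
  shows "C1_order (j + 2 * mi_order k) (\<lambda>z. fst z ^ j * mi_power (w z) k)"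
proof -
  have "C1_order (1 * j + (\<Sum>i\<in>UNIV. 2 * k $ i)) (\<lambda>z. fst z ^ j * (\<Prod>i\<in>UNIV. w z $ i ^ k $ i))"
    by (intro C1_order_mult C1_order_power C1_order_prod C1_order_fst assms)
  then show ?thesis by (simp add: mi_power_def mi_order_def sum_distrib_left)
qed

text \<open>
  On the graph, \<open>x\<^sup>j \<eta>\<^sup>k\<close> has order \<open>j + 2 \<bar>k\<bar>\<close>, so only the monomials in \<open>A\<close> can contribute
  below order \<open>m\<close>.
\<close>

lemma C1_order_nonlinearity_remainder:
  fixes c :: "nat \<Rightarrow> nat ^ 'n \<Rightarrow> real"
  assumes w: "\<And>i. C1_order 2 (\<lambda>z. w z $ i)" and A: "A \<subseteq> mi_range l"
    and m: "\<And>j k. (j, k) \<in> mi_range l - A \<Longrightarrow> m \<le> j + 2 * mi_order k"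
  shows "C1_order m (\<lambda>z. nonlinearity l c (fst z) (w z)
    - (\<Sum>(j, k)\<in>A. fst z ^ j * mi_power (w z) k * c j k))"
proof -
  have "C1_order m (\<lambda>z. \<Sum>p\<in>mi_range l - A. c (fst p) (snd p) * (fst z ^ fst p * mi_power (w z) (snd p)))"
    by (intro C1_order_sum C1_order_cmult C1_order_mono[OF C1_order_monomial[OF w]] m) simp
  moreover have "nonlinearity l c (fst z) (w z) - (\<Sum>(j, k)\<in>A. fst z ^ j * mi_power (w z) k * c j k)
     = (\<Sum>p\<in>mi_range l - A. c (fst p) (snd p) * (fst z ^ fst p * mi_power (w z) (snd p)))" for z
    unfolding nonlinearity_def mi_range_def[symmetric]
    by (subst sum.subset_diff[OF A finite_mi_range]) (simp add: case_prod_unfold mult_ac)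
  ultimately show ?thesis by simp
qed

lemma C1_order_nonlinearity:
  fixes c :: "nat \<Rightarrow> nat ^ 'n \<Rightarrow> real"
  assumes "\<And>i. C1_order 2 (\<lambda>z. w z $ i)"
  shows "C1_order 2 (\<lambda>z. nonlinearity l c (fst z) (w z))"
  using C1_order_nonlinearity_remainder[where A = "{}" and m = 2, OF assms]
  by (auto simp: mi_range_def)

lemma C1_order_nonlinearity_quadratic:
  fixes c :: "nat \<Rightarrow> nat ^ 'n \<Rightarrow> real"
  assumes w: "\<And>i. C1_order 2 (\<lambda>z. w z $ i)" and "2 \<le> l"
  shows "C1_order 3 (\<lambda>z. nonlinearity l c (fst z) (w z) - c 2 0 * (fst z)\<^sup>2)"
proof -
  have "3 \<le> j + 2 * mi_order k" if "(j, k) \<in> mi_range l - {(2, 0)}" for j and k :: "nat ^ 'n"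
    using that mi_order_zero_iff[of k] by (auto simp: mi_range_def)
  moreover have "{(2, 0 :: nat ^ 'n)} \<subseteq> mi_range l"
    using assms(2) mi_order_zero_iff[of "0 :: nat ^ 'n"] by (simp add: mi_range_def)
  ultimately have "C1_order 3 (\<lambda>z. nonlinearity l c (fst z) (w z)
      - (\<Sum>(j, k)\<in>{(2, 0)}. fst z ^ j * mi_power (w z) k * c j k))"
    by (intro C1_order_nonlinearity_remainder w)
  then show ?thesis by (simp add: mi_power_zero mult.commute)
qed

text \<open>
  Apart from the powers of \<open>x\<close>, only the monomials \<open>x \<eta>\<^sub>i\<close> have order \<open>j + 2 \<bar>k\<bar> = 3\<close>; those with
  \<open>\<bar>k\<bar> = 1\<close> and \<open>j \<ge> 2\<close> or with \<open>\<bar>k\<bar> \<ge> 2\<close> reach order four.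
\<close>

lemma C1_order_nonlinearity_cubic:
  fixes c :: "nat \<Rightarrow> nat ^ 'n \<Rightarrow> real"
  assumes w: "\<And>i. C1_order 2 (\<lambda>z. w z $ i)"
  shows "C1_order 4 (\<lambda>z. nonlinearity 3 c (fst z) (w z) - (c 2 0 * (fst z)\<^sup>2 + c 3 0 * fst z ^ 3
      + (\<Sum>i\<in>UNIV. c 1 (axis i 1) * (fst z * w z $ i))))"
proof -
  let ?X = "{(2, 0), (3, 0)} :: (nat \<times> (nat ^ 'n)) set"
  let ?Y = "range (\<lambda>i. (1, axis i 1)) :: (nat \<times> (nat ^ 'n)) set"
  have "4 \<le> j + 2 * mi_order k" if "(j, k) \<in> mi_range 3 - (?X \<union> ?Y)" for j and k :: "nat ^ 'n"
  proof (rule ccontr)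
    assume "\<not> ?thesis"
    with that have "mi_order k = 0 \<and> (j = 2 \<or> j = 3) \<or> mi_order k = 1 \<and> j = 1"
      by (auto simp: mi_range_def)
    then have "(j, k) \<in> ?X \<union> ?Y"
      using mi_order_eq_one[of k] by (auto simp: mi_order_zero_iff simp del: One_nat_def)
    with that show False by blast
  qed
  moreover have "?X \<union> ?Y \<subseteq> mi_range 3"
    using mi_order_zero_iff[of "0 :: nat ^ 'n"] by (auto simp: mi_range_def mi_order_axis simp del: One_nat_def)
  ultimately have "C1_order 4 (\<lambda>z. nonlinearity 3 c (fst z) (w z)
      - (\<Sum>(j, k)\<in>?X \<union> ?Y. fst z ^ j * mi_power (w z) k * c j k))"
    by (intro C1_order_nonlinearity_remainder w)
  moreover have "(\<Sum>(j, k)\<in>?X \<union> ?Y. fst z ^ j * mi_power (w z) k * c j k)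
     = c 2 0 * (fst z)\<^sup>2 + c 3 0 * fst z ^ 3 + (\<Sum>i\<in>UNIV. c 1 (axis i 1) * (fst z * w z $ i))" for z
  proof -
    have "inj (\<lambda>i. (1 :: nat, axis i 1 :: nat ^ 'n))"
      by (auto simp: inj_on_def axis_eq_axis)
    then have "(\<Sum>(j, k)\<in>?Y. fst z ^ j * mi_power (w z) k * c j k)
        = (\<Sum>i\<in>UNIV. c 1 (axis i 1) * (fst z * w z $ i))"
      by (subst sum.reindex) (simp_all add: mi_power_axis mult_ac del: One_nat_def)
    moreover have "?X \<inter> ?Y = {}" by auto
    ultimately show ?thesis
      by (subst sum.union_disjoint) (auto simp: mi_power_zero mult.commute)
  qed
  ultimately show ?thesis by simp
qed

section \<open>Diagonal matrices\<close>

lemma diag_mat_mult: "diag_mat u ** diag_mat v = diag_mat (\<chi> i. u $ i * v $ i)"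
  by (simp add: diag_mat_def matrix_matrix_mult_def vec_eq_iff if_distrib[of "\<lambda>x. x * _"]
      if_distrib[of "\<lambda>x. _ * x"] cong: if_cong)

lemma diag_mat_shift: "diag_mat u - a *\<^sub>R mat 1 = diag_mat (\<chi> i. u $ i - a)"
  by (simp add: diag_mat_def mat_def vec_eq_iff)

lemma diag_mat_vector: "diag_mat u *v x = (\<chi> i. u $ i * x $ i)"
  by (simp add: diag_mat_def matrix_vector_mult_def vec_eq_iff if_distrib[of "\<lambda>x. x * _"] cong: if_cong)

lemma diag_mat_one: "diag_mat (\<chi> i. 1) = mat 1"
  by (simp add: diag_mat_def mat_def vec_eq_iff)

lemma matrix_inv_diag_mat_vector:
  assumes "\<And>i. u $ i \<noteq> 0"
  shows "matrix_inv (diag_mat u) *v x = (\<chi> i. x $ i / u $ i)"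
proof -
  let ?A = "diag_mat u" and ?B = "diag_mat (\<chi> i. 1 / u $ i)"
  have AB: "?A ** ?B = mat 1" "?B ** ?A = mat 1"
    using assms by (simp_all add: diag_mat_mult diag_mat_one)
  have "matrix_inv ?A ** ?A = mat 1"
    unfolding matrix_inv_def by (rule someI2[where a = ?B]) (use AB in auto)
  then have "matrix_inv ?A *v (?A *v (?B *v x)) = ?B *v x"
    by (metis matrix_vector_mul_assoc matrix_vector_mul_lid)
  moreover have "?A *v (?B *v x) = x"
    using AB by (simp add: matrix_vector_mul_assoc)
  ultimately show ?thesis
    by (simp add: diag_mat_vector)
qed

section \<open>The quadratic part of the subcenter manifold\<close>

text \<open>
  A trajectory that stays in the graph projects to a curve in the \<open>(x, y)\<close>-plane, and the last
  component of its velocity is the derivative of \<open>w_dot\<close> along that curve.  Differentiability of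
  \<open>w_dot\<close> at the base point suffices, because the two expressions agree for small times and are only
  differentiated at time zero.
\<close>

lemma invariant_graph_acceleration:
  assumes inv: "locally_invariant (system_field \<omega> \<Omega> R S) (graph_param \<omega> R w ` U)"
    and z: "z \<in> U" and G: "((\<lambda>z. w_dot \<omega> R w z $ i) has_derivative G) (at z)"
  shows "G (snd z, reduced_acceleration \<omega> R w z)
    = - (((\<Omega> ** \<Omega>) *v w z) $ i + S (fst z) (w z) $ i)"
proof -
  let ?F = "system_field \<omega> \<Omega> R S" and ?v = "(snd z, reduced_acceleration \<omega> R w z)"
  obtain \<epsilon> \<gamma> where \<epsilon>: "0 < \<epsilon>" and \<gamma>0: "\<gamma> 0 = graph_param \<omega> R w z" and
    \<gamma>: "\<forall>t\<in>{-\<epsilon><..<\<epsilon>}. \<gamma> t \<in> graph_param \<omega> R w ` U \<and> (\<gamma> has_vector_derivative ?F (\<gamma> t)) (at t)"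
    using bspec[OF inv[unfolded locally_invariant_def] imageI[OF z]]
    by (elim exE conjE) (rule that)
  define u where "u t = (fst (\<gamma> t), fst (snd (\<gamma> t)))" for t
  have \<gamma>_graph: "snd (snd (snd (\<gamma> t))) = w_dot \<omega> R w (u t)" if "t \<in> {-\<epsilon><..<\<epsilon>}" for t
    using bspec[OF \<gamma> that] by (auto simp: graph_param_def u_def)
  have u0: "u 0 = z"
    using \<gamma>0 by (simp add: u_def graph_param_def case_prod_unfold)
  have d\<gamma>: "(\<gamma> has_derivative (\<lambda>t. t *\<^sub>R ?F (graph_param \<omega> R w z))) (at 0)"
    using bspec[OF \<gamma>, of 0] \<epsilon> \<gamma>0 by (simp add: has_vector_derivative_def)
  have F: "?F (graph_param \<omega> R w z) = (snd z, reduced_acceleration \<omega> R w z, w_dot \<omega> R w z,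
      - ((\<Omega> ** \<Omega>) *v w z + S (fst z) (w z)))"
    by (simp add: system_field_def graph_param_def reduced_acceleration_def case_prod_unfold)
  have "(u has_derivative (\<lambda>t. (fst (t *\<^sub>R ?F (graph_param \<omega> R w z)),
      fst (snd (t *\<^sub>R ?F (graph_param \<omega> R w z)))))) (at 0)"
    unfolding u_def[abs_def]
    by (intro has_derivative_Pair has_derivative_fst has_derivative_snd d\<gamma>)
  then have "(u has_derivative (\<lambda>t. t *\<^sub>R ?v)) (at 0)"
    by (simp add: F)
  then have "((\<lambda>t. w_dot \<omega> R w (u t) $ i) has_derivative (\<lambda>t. G (t *\<^sub>R ?v))) (at 0)"
    using G has_derivative_compose[of u _ 0 UNIV "\<lambda>z. w_dot \<omega> R w z $ i" G] by (simp add: u0)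
  moreover have "((\<lambda>t. snd (snd (snd (\<gamma> t))) $ i) has_derivative
      (\<lambda>t. snd (snd (snd (t *\<^sub>R ?F (graph_param \<omega> R w z)))) $ i)) (at 0)"
    by (intro bounded_linear.has_derivative[OF bounded_linear_vec_nth] has_derivative_snd d\<gamma>)
  then have "((\<lambda>t. w_dot \<omega> R w (u t) $ i) has_derivative
      (\<lambda>t. snd (snd (snd (t *\<^sub>R ?F (graph_param \<omega> R w z)))) $ i)) (at 0)"
    by (rule has_derivative_transform_within_open[of _ _ _ _ "{-\<epsilon><..<\<epsilon>}"])
       (use \<epsilon> \<gamma>_graph in auto)
  ultimately have "(\<lambda>t. G (t *\<^sub>R ?v)) = (\<lambda>t. snd (snd (snd (t *\<^sub>R ?F (graph_param \<omega> R w z)))) $ i)"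
    by (rule has_derivative_unique)
  from fun_cong[OF this, of 1] show ?thesis
    by (simp add: F)
qed

text \<open>
  Comparison of the coefficients of \<open>x\<^sup>2\<close>, \<open>x y\<close> and \<open>y\<^sup>2\<close> in \<open>L\<^sup>2 q + \<mu> q + \<sigma> x\<^sup>2 = 0\<close>, where \<open>L\<close> is
  the derivation of the harmonic oscillator and \<open>q\<close> the quadratic form with coefficients
  \<open>(a, b, c)\<close>.
\<close>

lemma subcenter_quadratic_coefficients:
  fixes a b c \<omega> \<mu> \<sigma> :: real
  assumes "- \<omega>\<^sup>2 * (2 * a - 2 * \<omega>\<^sup>2 * c) + \<mu> * a + \<sigma> = 0"
    and "2 * (- \<omega>\<^sup>2 * b) - 2 * \<omega>\<^sup>2 * b + \<mu> * b = 0"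
    and "(2 * a - 2 * \<omega>\<^sup>2 * c) + \<mu> * c = 0"
    and \<mu>: "\<mu> \<noteq> 0" "\<mu> - 4 * \<omega>\<^sup>2 \<noteq> 0"
  shows "a = - ((\<mu> - 2 * \<omega>\<^sup>2) * \<sigma> / (\<mu> * (\<mu> - 4 * \<omega>\<^sup>2)))" "b = 0"
    "c = 2 * (\<sigma> / (\<mu> * (\<mu> - 4 * \<omega>\<^sup>2)))"
proof -
  have "(\<mu> - 4 * \<omega>\<^sup>2) * b = 0" using assms(2) by (simp add: algebra_simps)
  then show "b = 0" using \<mu> by simp
  have a: "a = - ((\<mu> - 2 * \<omega>\<^sup>2) * c / 2)" using assms(3) by (simp add: field_simps)
  have "c * (\<mu> * (\<mu> - 4 * \<omega>\<^sup>2)) = 2 * \<sigma>"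
    using assms(1) unfolding a by (simp add: field_simps)
  then show c: "c = 2 * (\<sigma> / (\<mu> * (\<mu> - 4 * \<omega>\<^sup>2)))"
    using \<mu> by (simp add: eq_divide_eq)
  show "a = - ((\<mu> - 2 * \<omega>\<^sup>2) * \<sigma> / (\<mu> * (\<mu> - 4 * \<omega>\<^sup>2)))"
    unfolding a c by simp
qed

text \<open>
  Tangency removes the constant and linear coefficients of \<open>w\<close>.  Two differentiations along the field
  turn its quadratic part \<open>q\<close> into \<open>L\<^sup>2 q\<close> up to third order, and the invariance equation then says that
  the quadratic form of \<open>L\<^sup>2 q + \<mu> q + s x\<^sup>2\<close> is of third order, hence zero.
\<close>

lemma subcenter_manifold_jet:
  fixes w :: "real \<times> real \<Rightarrow> real ^ 'n" and freq :: "real ^ 'n"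
  defines "\<mu> \<equiv> \<lambda>i. (freq $ i)\<^sup>2"
  assumes lsm: "lyapunov_subcenter_manifold \<omega> (diag_mat freq) (nonlinearity l r) (nonlinearity l s) w"
    and "2 \<le> l" and \<mu>: "\<mu> i \<noteq> 0" "\<mu> i - 4 * \<omega>\<^sup>2 \<noteq> 0"
  shows "C1_order 3 (\<lambda>z. w z $ i - quad_form
      (- ((\<mu> i - 2 * \<omega>\<^sup>2) * s 2 0 $ i / (\<mu> i * (\<mu> i - 4 * \<omega>\<^sup>2)))) 0
      (2 * (s 2 0 $ i / (\<mu> i * (\<mu> i - 4 * \<omega>\<^sup>2)))) z)"
    and "C1_order 2 (\<lambda>z. w z $ i)"
proof -
  let ?R = "nonlinearity l r" and ?S = "nonlinearity l s"
  obtain U where U: "open U" "(0, 0) \<in> U" "real_analytic_on2 w U"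
    "locally_invariant (system_field \<omega> (diag_mat freq) ?R ?S) (graph_param \<omega> ?R w ` U)"
    using lsm unfolding lyapunov_subcenter_manifold_def by blast
  have w0: "w 0 = 0"
    using lsm by (simp add: lyapunov_subcenter_manifold_def graph_param_def zero_prod_def)
  obtain D where D: "(graph_param \<omega> ?R w has_derivative D) (at (0, 0))"
    "range D = {(x, y, \<eta>, \<zeta>). \<eta> = 0 \<and> \<zeta> = 0}"
    using lsm unfolding lyapunov_subcenter_manifold_def by blast
  have "fst (snd (snd (D h))) = 0" for h
    using rangeI[of D h] unfolding D(2) by auto
  then have dw0: "((\<lambda>z. fst (snd (snd (graph_param \<omega> ?R w z)))) has_derivative (\<lambda>h. 0)) (at (0, 0))"
    using has_derivative_fst[OF has_derivative_snd[OF has_derivative_snd[OF D(1)]]] by simp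
  have dw: "(w has_derivative (\<lambda>h. 0)) (at 0)"
    using dw0 by (simp add: graph_param_def case_prod_unfold zero_prod_def)
  obtain \<rho> c where \<rho>: "0 < \<rho>" and c: "\<And>i. coeff_summable (c i) \<rho>"
    and wc: "\<And>i z. norm z \<le> \<rho> \<Longrightarrow> w z $ i = power_series2 (c i) z"
    by (rule analytic_component_power_series[OF U(3,2)]) (rule that)
  define \<tau> where "\<tau> = \<rho> / 2"
  have \<tau>: "0 < \<tau>" "\<tau> < \<rho>" using \<rho> by (auto simp: \<tau>_def)
  let ?X = "\<lambda>i. power_series2 (coeff_dx (c i))" and ?Y = "\<lambda>i. power_series2 (coeff_dy (c i))"
  have dwi: "((\<lambda>z. w z $ i) has_derivative (\<lambda>h. fst h * ?X i z + snd h * ?Y i z)) (at z)"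
    if "norm z < \<tau>" for z i
    by (rule has_derivative_transform_within_open[OF
          power_series2_has_derivative[OF c \<tau> that], of "ball 0 \<tau>"])
       (use that wc \<tau> in auto)
  have low: "c i 0 0 = 0" "c i 1 0 = 0" "c i 0 1 = 0" for i
  proof -
    show "c i 0 0 = 0"
      using power_series2_at_zero[OF c \<rho>, of i] wc[of 0 i] w0 \<rho> by simp
    have "(\<lambda>h. fst h * ?X i 0 + snd h * ?Y i 0) = (\<lambda>h. 0)"
    proof (rule has_derivative_unique)
      show "((\<lambda>z. w z $ i) has_derivative (\<lambda>h. fst h * ?X i 0 + snd h * ?Y i 0)) (at 0)"
        by (rule dwi) (use \<tau> in simp)
      show "((\<lambda>z. w z $ i) has_derivative (\<lambda>h. 0)) (at 0)"
        using bounded_linear.has_derivative[OF bounded_linear_vec_nth[of i] dw] by simp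
    qed
    from fun_cong[OF this, of "(1, 0)"] fun_cong[OF this, of "(0, 1)"]
    show "c i 1 0 = 0" "c i 0 1 = 0"
      using power_series2_at_zero[OF coeff_summable_dx[OF c \<tau>] \<tau>(1), of i]
        power_series2_at_zero[OF coeff_summable_dy[OF c \<tau>] \<tau>(1), of i]
      by (simp_all add: coeff_dx_def coeff_dy_def)
  qed
  have w2: "C1_order 2 (\<lambda>z. w z $ i)" for i
  proof (rule C1_order_cong)
    show "C1_order 2 (power_series2 (c i))"
    proof (rule C1_order_power_series2[OF c \<rho>])
      fix j k :: nat assume "j + k < 2"
      then have "(j, k) \<in> {(0, 0), (1, 0), (0, 1)}" by auto
      then show "c i j k = 0" using low by auto
    qed
    show "\<forall>\<^sub>F z in nhds 0. power_series2 (c i) z = w z $ i"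
      using eventually_norm_less[OF \<rho>] by eventually_elim (simp add: wc)
  qed
  then show "C1_order 2 (\<lambda>z. w z $ i)" .
  define \<phi> where "\<phi> z = ?R (fst z) (w z)" for z
  have \<phi>: "C1_order 2 \<phi>"
    unfolding \<phi>_def[abs_def] by (rule C1_order_nonlinearity[OF w2])
  let ?V = "\<lambda>z. (snd z, - (\<omega>\<^sup>2 * fst z + \<phi> z))"
  have acc: "reduced_acceleration \<omega> ?R w z = - (\<omega>\<^sup>2 * fst z + \<phi> z)" for z
    by (simp add: reduced_acceleration_def \<phi>_def case_prod_unfold)
  have wdot: "w_dot \<omega> ?R w z $ i = snd z * ?X i z + - (\<omega>\<^sup>2 * fst z + \<phi> z) * ?Y i z"
    if "norm z < \<tau>" for z
  proof -
    have "(w has_derivative (\<lambda>h. \<chi> i. fst h * ?X i z + snd h * ?Y i z)) (at z)"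
      by (rule has_derivative_vec_componentwise) (simp add: dwi[OF that])
    then have "frechet_derivative w (at z) = (\<lambda>h. \<chi> i. fst h * ?X i z + snd h * ?Y i z)"
      by (rule frechet_derivative_at[symmetric])
    then show ?thesis
      by (simp add: w_dot_def acc)
  qed
  let ?a = "c i 2 0" and ?b = "c i 1 1" and ?c = "c i 0 2"
  \<comment> \<open>The coefficients of the derivative of the quadratic part along the oscillator.\<close>
  let ?a' = "- \<omega>\<^sup>2 * ?b" and ?b' = "2 * ?a - 2 * \<omega>\<^sup>2 * ?c" and ?c' = ?b
  obtain e' where e': "C1_order 3 e'" "\<forall>\<^sub>F z in nhds 0.
      snd z * ?X i z + - (\<omega>\<^sup>2 * fst z + \<phi> z) * ?Y i z = quad_form ?a' ?b' ?c' z + e' z"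
    using c \<rho> low \<phi> by (rule power_series2_along_field)
  from e'(2) eventually_norm_less[OF \<tau>(1)]
  have "\<forall>\<^sub>F z in nhds 0. w_dot \<omega> ?R w z $ i = quad_form ?a' ?b' ?c' z + e' z"
    by eventually_elim (simp add: wdot)
  then obtain G K where G: "\<forall>\<^sub>F z in nhds 0. ((\<lambda>z. w_dot \<omega> ?R w z $ i) has_derivative G z) (at z) \<and>
      \<bar>G z (?V z) - quad_form (- \<omega>\<^sup>2 * ?b') (2 * ?a' - 2 * \<omega>\<^sup>2 * ?c') ?b' z\<bar> \<le> K * norm z ^ 3"
    by (rule quad_form_along_field[OF e'(1) \<phi>])
  define e where "e = power_series2 (coeff_tail 3 (c i))"
  have e: "C1_order 3 e"
    unfolding e_def by (rule C1_order_power_series2_tail[OF c \<rho>])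
  have we: "w z $ i = quad_form ?a ?b ?c z + e z" if "norm z \<le> \<rho>" for z
    using power_series2_split[OF c \<rho> that, of i 3] wc[OF that, of i] low[of i]
    by (simp add: e_def quad_form_def eval_nat_numeral)
  define f where "f z = ?S (fst z) (w z) $ i - s 2 0 $ i * (fst z)\<^sup>2" for z
  have f: "C1_order 3 f"
    unfolding f_def[abs_def] nonlinearity_component
    by (rule C1_order_nonlinearity_quadratic[OF w2 \<open>2 \<le> l\<close>])
  obtain E L where "\<forall>\<^sub>F z in nhds 0. (e has_derivative E z) (at z) \<and>
     \<bar>e z\<bar> \<le> L * norm z ^ 3 \<and> (\<forall>h. \<bar>E z h\<bar> \<le> L * norm z ^ (3 - 1) * norm h)"
    using e by (rule C1_orderE)
  moreover obtain F M where "\<forall>\<^sub>F z in nhds 0. (f has_derivative F z) (at z) \<and>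
     \<bar>f z\<bar> \<le> M * norm z ^ 3 \<and> (\<forall>h. \<bar>F z h\<bar> \<le> M * norm z ^ (3 - 1) * norm h)"
    using f by (rule C1_orderE)
  moreover have "\<forall>\<^sub>F z in nhds 0. z \<in> U"
    using U(1,2) by (auto simp: eventually_nhds zero_prod_def)
  ultimately have "\<forall>\<^sub>F z in nhds 0. \<bar>quad_form (- \<omega>\<^sup>2 * ?b' + \<mu> i * ?a + s 2 0 $ i)
      (2 * ?a' - 2 * \<omega>\<^sup>2 * ?c' + \<mu> i * ?b) (?b' + \<mu> i * ?c) z\<bar> \<le> (K + \<bar>\<mu> i\<bar> * L + M) * norm z ^ 3"
    using G eventually_norm_less[OF \<rho>]
  proof eventually_elim
    case (elim z)
    have "G z (?V z) = - ((diag_mat freq ** diag_mat freq *v w z) $ i + ?S (fst z) (w z) $ i)"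
      using invariant_graph_acceleration[OF U(4), of z i "G z"] elim by (simp add: acc)
    also have "\<dots> = - (\<mu> i * (quad_form ?a ?b ?c z + e z) + (s 2 0 $ i * (fst z)\<^sup>2 + f z))"
      using we[of z] elim
      by (simp add: diag_mat_mult diag_mat_vector \<mu>_def f_def power2_eq_square)
    finally have "quad_form (- \<omega>\<^sup>2 * ?b' + \<mu> i * ?a + s 2 0 $ i)
      (2 * ?a' - 2 * \<omega>\<^sup>2 * ?c' + \<mu> i * ?b) (?b' + \<mu> i * ?c) z
      = - (G z (?V z) - quad_form (- \<omega>\<^sup>2 * ?b') (2 * ?a' - 2 * \<omega>\<^sup>2 * ?c') ?b' z)
        - \<mu> i * e z - f z"
      by (simp add: quad_form_def algebra_simps)
    moreover have "\<bar>\<mu> i * e z\<bar> \<le> \<bar>\<mu> i\<bar> * L * norm z ^ 3"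
      unfolding abs_mult mult.assoc using elim by (intro mult_left_mono) auto
    moreover have "\<bar>f z\<bar> \<le> M * norm z ^ 3" using elim by blast
    moreover have "\<bar>G z (?V z) - quad_form (- \<omega>\<^sup>2 * ?b') (2 * ?a' - 2 * \<omega>\<^sup>2 * ?c') ?b' z\<bar> \<le> K * norm z ^ 3"
      using elim by blast
    ultimately show ?case unfolding distrib_right by linarith
  qed
  from quad_form_eq_zero[OF this]
  have "?a = - ((\<mu> i - 2 * \<omega>\<^sup>2) * s 2 0 $ i / (\<mu> i * (\<mu> i - 4 * \<omega>\<^sup>2)))" "?b = 0"
    "?c = 2 * (s 2 0 $ i / (\<mu> i * (\<mu> i - 4 * \<omega>\<^sup>2)))"
    using subcenter_quadratic_coefficients[OF _ _ _ \<mu>, of ?a ?c "s 2 0 $ i" ?b] by blast+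
  then have "\<forall>\<^sub>F z in nhds 0. e z = w z $ i - quad_form
      (- ((\<mu> i - 2 * \<omega>\<^sup>2) * s 2 0 $ i / (\<mu> i * (\<mu> i - 4 * \<omega>\<^sup>2)))) 0
      (2 * (s 2 0 $ i / (\<mu> i * (\<mu> i - 4 * \<omega>\<^sup>2)))) z"
    using eventually_norm_less[OF \<rho>] we by (auto elim!: eventually_mono)
  then show "C1_order 3 (\<lambda>z. w z $ i - quad_form
      (- ((\<mu> i - 2 * \<omega>\<^sup>2) * s 2 0 $ i / (\<mu> i * (\<mu> i - 4 * \<omega>\<^sup>2)))) 0
      (2 * (s 2 0 $ i / (\<mu> i * (\<mu> i - 4 * \<omega>\<^sup>2)))) z)"
    by (rule C1_order_cong[OF e])
qed

section \<open>The reduced model\<close>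

text \<open>
  Only the resonances \<open>\<nu> / \<omega> \<in> {0, 2, - 2}\<close> obstruct the quadratic part.
\<close>

lemma nonresonant_square:
  fixes \<nu> \<omega> :: real
  assumes "\<omega> > 0" "\<nu> / \<omega> \<notin> \<int>"
  shows "\<nu>\<^sup>2 \<noteq> 0" "\<nu>\<^sup>2 - 4 * \<omega>\<^sup>2 \<noteq> 0"
proof -
  show "\<nu>\<^sup>2 \<noteq> 0" using assms by auto
  show "\<nu>\<^sup>2 - 4 * \<omega>\<^sup>2 \<noteq> 0"
  proof
    assume "\<nu>\<^sup>2 - 4 * \<omega>\<^sup>2 = 0"
    then have "\<nu>\<^sup>2 = (2 * \<omega>)\<^sup>2" by (simp add: power_mult_distrib)
    then have "\<nu> = 2 * \<omega> \<or> \<nu> = - (2 * \<omega>)" by (rule power2_eq_iff[THEN iffD1])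
    then have "\<nu> / \<omega> = 2 \<or> \<nu> / \<omega> = - 2" using assms(1) by (auto simp: field_simps)
    then show False using assms(2) by auto
  qed
qed

theorem theorem2p2:
  fixes \<omega> :: real
    and freq :: "real ^ 'n"
    and l :: nat
    and r :: "nat \<Rightarrow> nat ^ 'n \<Rightarrow> real"
    and s :: "nat \<Rightarrow> nat ^ 'n \<Rightarrow> real ^ 'n"
    and w :: "real \<times> real \<Rightarrow> real ^ 'n"
  defines "\<Omega> \<equiv> diag_mat freq"
    and "R \<equiv> nonlinearity l r"
    and "S \<equiv> nonlinearity l s"
    and "D2 \<equiv> diag_mat freq ** diag_mat freq - (2 * \<omega>\<^sup>2) *\<^sub>R mat 1"
    and "D4 \<equiv> diag_mat freq ** diag_mat freq - (4 * \<omega>\<^sup>2) *\<^sub>R mat 1"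
    and "r1I \<equiv> (\<chi> i. r 1 (axis i 1))"
  assumes "\<omega> > 0"
    and "2 \<le> l" and "l \<le> 3"
    and "\<And>j k. l < j + mi_order k \<Longrightarrow> r j k = 0"
    and "\<And>j k. l < j + mi_order k \<Longrightarrow> s j k = 0"
    and "\<And>i. freq $ i / \<omega> \<notin> \<int>"
    and "lyapunov_subcenter_manifold \<omega> \<Omega> R S w"
  shows "(\<lambda>(x, y). reduced_acceleration \<omega> R w (x, y) + \<omega>\<^sup>2 * x + r 2 0 * x\<^sup>2
            + (r 3 0 - r1I \<bullet> (matrix_inv (\<Omega> ** \<Omega> ** D4) *v (D2 *v s 2 0))) * x ^ 3
            + 2 * (r1I \<bullet> (matrix_inv (\<Omega> ** \<Omega> ** D4) *v s 2 0)) * x * y\<^sup>2)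
         \<in> O[nhds (0, 0)](\<lambda>z. norm z ^ 4)"
proof -
  define \<mu> where "\<mu> i = (freq $ i)\<^sup>2" for i
  define b where "b i = s 2 0 $ i / (\<mu> i * (\<mu> i - 4 * \<omega>\<^sup>2))" for i
  have \<mu>: "\<mu> i \<noteq> 0" "\<mu> i - 4 * \<omega>\<^sup>2 \<noteq> 0" for i
    unfolding \<mu>_def using nonresonant_square[OF \<open>\<omega> > 0\<close> assms(12)] by blast+
  have D: "D2 = diag_mat (\<chi> i. \<mu> i - 2 * \<omega>\<^sup>2)"
    "\<Omega> ** \<Omega> ** D4 = diag_mat (\<chi> i. \<mu> i * (\<mu> i - 4 * \<omega>\<^sup>2))"
    by (simp_all add: D2_def D4_def \<Omega>_def diag_mat_mult diag_mat_shift \<mu>_def power2_eq_square)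
  have inv: "matrix_inv (\<Omega> ** \<Omega> ** D4) *v x = (\<chi> i. x $ i / (\<mu> i * (\<mu> i - 4 * \<omega>\<^sup>2)))" for x
    unfolding D by (subst matrix_inv_diag_mat_vector) (use \<mu> in auto)
  have p: "r1I \<bullet> (matrix_inv (\<Omega> ** \<Omega> ** D4) *v (D2 *v s 2 0))
      = (\<Sum>i\<in>UNIV. r 1 (axis i 1) * ((\<mu> i - 2 * \<omega>\<^sup>2) * b i))"
    unfolding inv by (simp add: D(1) diag_mat_vector inner_vec_def r1I_def b_def)
  have q: "r1I \<bullet> (matrix_inv (\<Omega> ** \<Omega> ** D4) *v s 2 0) = (\<Sum>i\<in>UNIV. r 1 (axis i 1) * b i)"
    unfolding inv by (simp add: inner_vec_def r1I_def b_def)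
  have R3: "R = nonlinearity 3 r"
    unfolding R_def by (rule nonlinearity_mono) (use assms in auto)
  have lsm: "lyapunov_subcenter_manifold \<omega> (diag_mat freq) (nonlinearity l r) (nonlinearity l s) w"
    using assms(13) by (simp add: \<Omega>_def R_def S_def)
  define e where "e i z = w z $ i - quad_form (- ((\<mu> i - 2 * \<omega>\<^sup>2) * b i)) 0 (2 * b i) z" for i z
  have e: "C1_order 3 (e i)" and w2: "C1_order 2 (\<lambda>z. w z $ i)" for i
    using subcenter_manifold_jet[OF lsm \<open>2 \<le> l\<close>, of i] \<mu>
    by (simp_all add: \<mu>_def e_def[abs_def] b_def)
  define g where "g z = R (fst z) (w z) - (r 2 0 * (fst z)\<^sup>2 + r 3 0 * fst z ^ 3
      + (\<Sum>i\<in>UNIV. r 1 (axis i 1) * (fst z * w z $ i)))" for z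
  have "C1_order 4 g"
    unfolding g_def[abs_def] R3 by (rule C1_order_nonlinearity_cubic[OF w2])
  moreover have "C1_order (1 + 3) (\<lambda>z. \<Sum>i\<in>UNIV. r 1 (axis i 1) * (fst z * e i z))"
    by (intro C1_order_sum C1_order_cmult C1_order_mult C1_order_fst e)
  ultimately have "C1_order 4 (\<lambda>z. - 1 * (g z + (\<Sum>i\<in>UNIV. r 1 (axis i 1) * (fst z * e i z))))"
    by (intro C1_order_cmult C1_order_add) simp_all
  moreover have "- 1 * (g z + (\<Sum>i\<in>UNIV. r 1 (axis i 1) * (fst z * e i z)))
     = (case z of (x, y) \<Rightarrow> reduced_acceleration \<omega> R w (x, y) + \<omega>\<^sup>2 * x + r 2 0 * x\<^sup>2
            + (r 3 0 - r1I \<bullet> (matrix_inv (\<Omega> ** \<Omega> ** D4) *v (D2 *v s 2 0))) * x ^ 3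
            + 2 * (r1I \<bullet> (matrix_inv (\<Omega> ** \<Omega> ** D4) *v s 2 0)) * x * y\<^sup>2)" for z
  proof -
    obtain x y where z: "z = (x, y)" by fastforce
    \<comment> \<open>The quadratic parts of the \<open>w\<^sub>i\<close> yield the cubic terms of the reduced model.\<close>
    have "r 1 (axis i 1) * (x * w z $ i) = r 1 (axis i 1) * (x * e i z)
        - r 1 (axis i 1) * ((\<mu> i - 2 * \<omega>\<^sup>2) * b i) * x ^ 3 + r 1 (axis i 1) * b i * (2 * x * y\<^sup>2)" for i
      by (simp add: e_def quad_form_def z power2_eq_square power3_eq_cube algebra_simps)
    then have "(\<Sum>i\<in>UNIV. r 1 (axis i 1) * (x * w z $ i))
        = (\<Sum>i\<in>UNIV. r 1 (axis i 1) * (x * e i z))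
        - (\<Sum>i\<in>UNIV. r 1 (axis i 1) * ((\<mu> i - 2 * \<omega>\<^sup>2) * b i)) * x ^ 3
        + (\<Sum>i\<in>UNIV. r 1 (axis i 1) * b i) * (2 * x * y\<^sup>2)"
      by (simp only: sum.distrib sum_subtractf sum_distrib_right)
    then show ?thesis
      unfolding p q by (simp add: z g_def reduced_acceleration_def algebra_simps)
  qed
  ultimately show ?thesis
    using C1_order_imp_bigo by (simp add: zero_prod_def)
qed

end
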